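(* Let $\mathbb M$ be a holonomic $\mathbb W_t=\mathbb C[t]\langle\partial_t\rangle$-module. Then the map $$\Upsilon^0:\mu(\widehat{\mathbb M})\longrightarrow\mathcal E^{(\infty,0)}(\mathbb M),\qquad\alpha\otimes\widehat m\longmapsto\alpha\otimes m,$$ is an isomorphism of $\mathbb C\{\eta\}\langle\partial_\eta\rangle$-modules and of $\mathbb C\{t^{-1}\}[t]$-vector spaces.
   Context: Modules are left modules unless stated otherwise; the base field is $\mathbb C$. $\mathbb W_t=\mathbb C[t]\langle\partial_t\rangle$, $\mathbb W_\eta=\mathbb C[\eta]\langle\partial_\eta\rangle$ are Weyl algebras. A $\mathbb W_t$-module is holonomic if it is finitely generated and every element is annihilated by a nonzero element of $\mathbb W_t$. The Fourier transform is $\widehat{\mathbb M}=\mathbb W_\eta\otimes_{\mathbb W_t}\mathbb M$, with $\mathbb W_\eta$ a right $\mathbb W_t$-module via $t\mapsto-\partial_\eta$, $\partial_t\mapsto\eta$; $\widehat m=1\otimes m$. $\mathbb C\{\cdot\}$ denotes convergent power series. $\mathcal E^{(\infty,0)}$ is the set of formal sums $P=\sum_{i\le r}a_i(\eta)\,t^i$, $r\in\mathbb Z$, such that there is $\rho_0>0$ with all $a_i(\eta)$ convergent power series in $|\eta|<\rho_0$, and there are $0<\rho<\rho_0$, $\theta>0$ with $\sum_{k\ge0}\|a_{-k}\|_\rho\frac{\theta^k}{k!}$ convergent, where $\|a_{-k}\|_\rho=\sup_{|z|\le\rho}|a_{-k}(z)|$. It is a ring for the product $P\cdot Q=\sum_{\alpha\ge0}\frac1{\alpha!}\partial_t^\alpha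 P\cdot\partial_\eta^\alpha Q$ (commutative product on the right-hand side). Put $\mathcal E^{(\infty,0)}(\mathbb M)=\mathcal E^{(\infty,0)}\otimes_{\mathbb W_t}\mathbb M$, where $\mathcal E^{(\infty,0)}$ is a right $\mathbb W_t$-module via the $\mathbb C$-algebra morphism $\mathbb W_t\to\mathcal E^{(\infty,0)}$, $t\mapsto-t$, $\partial_t\mapsto\eta$. For a $\mathbb W_\eta$-module $\mathbb N$ put $\mu(\mathbb N)=\mathcal E^{(\infty,0)}\otimes_{\mathbb W_\eta}\mathbb N$, where $\mathcal E^{(\infty,0)}$ is a right $\mathbb W_\eta$-module via the $\mathbb C$-algebra morphism $\mathbb W_\eta\to\mathcal E^{(\infty,0)}$, $\eta\mapsto\eta$, $\partial_\eta\mapsto t$. Both $\mathcal E^{(\infty,0)}(\mathbb M)$ and $\mu(\mathbb N)$ are $\mathbb C\{t^{-1}\}[t]$-vector spaces and $\mathbb C\{\eta\}\langle\partial_\eta\rangle$-modules by left multiplication, where $\partial_\eta$ acts by left multiplication by $t$. *)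

theory Defs
  imports
    "HOL-Algebra.Module"
    "HOL-Algebra.Free_Abelian_Groups"
    "HOL-Algebra.Generated_Groups"
    "HOL-Library.Groups_Big_Fun"
    "HOL-Computational_Algebra.Polynomial"
    "HOL-Complex_Analysis.Laurent_Convergence"
begin

section \<open>Left modules over noncommutative rings\<close>

text \<open>The library locale \<^locale>\<open>module\<close> requires a commutative ring of scalars.\<close>

locale left_module = R?: ring R + M?: abelian_group M
  for R (structure) and M :: "('a, 'b, 'c) module_scheme" (structure) +
  assumes smult_closed [simp, intro]:
      "\<lbrakk>a \<in> carrier R; x \<in> carrier M\<rbrakk> \<Longrightarrow> a \<odot>\<^bsub>M\<^esub> x \<in> carrier M"
    and smult_l_distr:
      "\<lbrakk>a \<in> carrier R; b \<in> carrier R; x \<in> carrier M\<rbrakk>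
        \<Longrightarrow> (a \<oplus> b) \<odot>\<^bsub>M\<^esub> x = a \<odot>\<^bsub>M\<^esub> x \<oplus>\<^bsub>M\<^esub> b \<odot>\<^bsub>M\<^esub> x"
    and smult_r_distr:
      "\<lbrakk>a \<in> carrier R; x \<in> carrier M; y \<in> carrier M\<rbrakk>
        \<Longrightarrow> a \<odot>\<^bsub>M\<^esub> (x \<oplus>\<^bsub>M\<^esub> y) = a \<odot>\<^bsub>M\<^esub> x \<oplus>\<^bsub>M\<^esub> a \<odot>\<^bsub>M\<^esub> y"
    and smult_assoc:
      "\<lbrakk>a \<in> carrier R; b \<in> carrier R; x \<in> carrier M\<rbrakk>
        \<Longrightarrow> (a \<otimes> b) \<odot>\<^bsub>M\<^esub> x = a \<odot>\<^bsub>M\<^esub> (b \<odot>\<^bsub>M\<^esub> x)"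
    and smult_one [simp]:
      "x \<in> carrier M \<Longrightarrow> \<one> \<odot>\<^bsub>M\<^esub> x = x"

definition left_module_iso ::
    "('r, 's) ring_scheme \<Rightarrow> ('r, 'a, 'c) module_scheme \<Rightarrow> ('r, 'b, 'd) module_scheme \<Rightarrow> ('a \<Rightarrow> 'b) \<Rightarrow> bool" where
  "left_module_iso R M N f \<longleftrightarrow>
     left_module R M \<and> left_module R N \<and>
     f \<in> iso (add_monoid M) (add_monoid N) \<and>
     (\<forall>r\<in>carrier R. \<forall>x\<in>carrier M. f (r \<odot>\<^bsub>M\<^esub> x) = r \<odot>\<^bsub>N\<^esub> f x)"

definition finitely_generated_module ::
    "('r, 's) ring_scheme \<Rightarrow> ('r, 'a, 'c) module_scheme \<Rightarrow> bool" where
  "finitely_generated_module R M \<longleftrightarrow>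
     (\<exists>S. finite S \<and> S \<subseteq> carrier M \<and>
        (\<forall>m\<in>carrier M. \<exists>f \<in> S \<rightarrow> carrier R. m = (\<Oplus>\<^bsub>M\<^esub>s\<in>S. f s \<odot>\<^bsub>M\<^esub> s)))"

text \<open>The multiplicative fields inherited from the ring record are irrelevant for modules.\<close>

definition restrict_scalars :: "('r \<Rightarrow> 's) \<Rightarrow> ('s, 'a, 'c) module_scheme \<Rightarrow> ('r, 'a) module" where
  "restrict_scalars h M =
     \<lparr>carrier = carrier M, monoid.mult = undefined, one = undefined, ring.zero = \<zero>\<^bsub>M\<^esub>, ring.add = add M,
      module.smult = (\<lambda>r x. h r \<odot>\<^bsub>M\<^esub> x)\<rparr>"


section \<open>Tensor products\<close>

text \<open>For \<open>h : A \<rightarrow> B\<close> the ring \<open>B\<close> is a right \<open>A\<close>-module via \<open>b \<cdot> a = b h(a)\<close>. The tensor product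
  \<open>B \<otimes>\<^sub>A M\<close> is the free abelian group on \<open>B \<times> M\<close> modulo the subgroup generated by the
  bilinearity and balancing relations.\<close>

definition tensor_free ::
    "('b, 't) ring_scheme \<Rightarrow> ('a, 'm, 'c) module_scheme \<Rightarrow> ('b \<times> 'm \<Rightarrow>\<^sub>0 int) monoid" where
  "tensor_free B M = free_Abelian_group (carrier B \<times> carrier M)"

definition tensor_relations ::
    "('a, 's) ring_scheme \<Rightarrow> ('b, 't) ring_scheme \<Rightarrow> ('a \<Rightarrow> 'b) \<Rightarrow> ('a, 'm, 'c) module_scheme
      \<Rightarrow> ('b \<times> 'm \<Rightarrow>\<^sub>0 int) set" where
  "tensor_relations A B h M =
     {frag_of (b \<oplus>\<^bsub>B\<^esub> c, m) - frag_of (b, m) - frag_of (c, m) | b c m.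
        b \<in> carrier B \<and> c \<in> carrier B \<and> m \<in> carrier M} \<union>
     {frag_of (b, m \<oplus>\<^bsub>M\<^esub> n) - frag_of (b, m) - frag_of (b, n) | b m n.
        b \<in> carrier B \<and> m \<in> carrier M \<and> n \<in> carrier M} \<union>
     {frag_of (b \<otimes>\<^bsub>B\<^esub> h a, m) - frag_of (b, a \<odot>\<^bsub>M\<^esub> m) | a b m.
        a \<in> carrier A \<and> b \<in> carrier B \<and> m \<in> carrier M}"

definition tensor_null ::
    "('a, 's) ring_scheme \<Rightarrow> ('b, 't) ring_scheme \<Rightarrow> ('a \<Rightarrow> 'b) \<Rightarrow> ('a, 'm, 'c) module_scheme
      \<Rightarrow> ('b \<times> 'm \<Rightarrow>\<^sub>0 int) set" where
  "tensor_null A B h M = generate (tensor_free B M) (tensor_relations A B h M)"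

definition tensor_class ::
    "('a, 's) ring_scheme \<Rightarrow> ('b, 't) ring_scheme \<Rightarrow> ('a \<Rightarrow> 'b) \<Rightarrow> ('a, 'm, 'c) module_scheme
      \<Rightarrow> ('b \<times> 'm \<Rightarrow>\<^sub>0 int) \<Rightarrow> ('b \<times> 'm \<Rightarrow>\<^sub>0 int) set" where
  "tensor_class A B h M c = tensor_null A B h M #>\<^bsub>tensor_free B M\<^esub> c"

definition pure_tensor ::
    "('a, 's) ring_scheme \<Rightarrow> ('b, 't) ring_scheme \<Rightarrow> ('a \<Rightarrow> 'b) \<Rightarrow> ('a, 'm, 'c) module_scheme
      \<Rightarrow> 'b \<Rightarrow> 'm \<Rightarrow> ('b \<times> 'm \<Rightarrow>\<^sub>0 int) set" where
  "pure_tensor A B h M b m = tensor_class A B h M (frag_of (b, m))"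

text \<open>\<open>B \<otimes>\<^sub>A M\<close> as a left \<open>B\<close>-module. In the scalar multiplication the union runs over the
  representatives of a class; they all yield the same class.\<close>

definition extend_scalars ::
    "('a, 's) ring_scheme \<Rightarrow> ('b, 't) ring_scheme \<Rightarrow> ('a \<Rightarrow> 'b) \<Rightarrow> ('a, 'm, 'c) module_scheme
      \<Rightarrow> ('b, ('b \<times> 'm \<Rightarrow>\<^sub>0 int) set) module" where
  "extend_scalars A B h M =
     (let Q = tensor_free B M Mod tensor_null A B h M in
      \<lparr>carrier = carrier Q, monoid.mult = undefined, one = undefined,
       ring.zero = \<one>\<^bsub>Q\<^esub>, ring.add = monoid.mult Q,
       module.smult = (\<lambda>b X. \<Union>c\<in>X. tensor_class A B h M
                  (frag_extend (\<lambda>(b', m). frag_of (b \<otimes>\<^bsub>B\<^esub> b', m)) c))\<rparr>)"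


section \<open>Rings of differential operators in one variable\<close>

text \<open>For a commutative ring \<open>K\<close> with a derivation \<open>\<delta>\<close>, the ring \<open>K\<langle>\<partial>\<rangle>\<close> consists of the
  polynomials \<open>\<Sum>\<^sub>j a\<^sub>j \<partial>\<^sup>j\<close> with coefficients in \<open>K\<close> written on the left, and its product is
  determined by \<open>\<partial> a = a \<partial> + \<delta>(a)\<close>.\<close>

definition partial_lmult :: "('k::comm_ring_1 \<Rightarrow> 'k) \<Rightarrow> 'k poly \<Rightarrow> 'k poly" where
  "partial_lmult \<delta> Q = pCons 0 Q + map_poly \<delta> Q"

definition diff_op_mult :: "('k::comm_ring_1 \<Rightarrow> 'k) \<Rightarrow> 'k poly \<Rightarrow> 'k poly \<Rightarrow> 'k poly" where
  "diff_op_mult \<delta> P Q = (\<Sum>i\<le>degree P. Polynomial.smult (coeff P i) ((partial_lmult \<delta> ^^ i) Q))"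

definition diff_op_ring :: "'k::comm_ring_1 set \<Rightarrow> ('k \<Rightarrow> 'k) \<Rightarrow> 'k poly ring" where
  "diff_op_ring K \<delta> =
     \<lparr>carrier = {P. \<forall>i. coeff P i \<in> K}, monoid.mult = diff_op_mult \<delta>, one = 1, ring.zero = 0, ring.add = (+)\<rparr>"

text \<open>The Weyl algebra \<open>\<complex>[x]\<langle>\<partial>\<^sub>x\<rangle>\<close>, used both for \<open>x = t\<close> and for \<open>x = \<eta>\<close>.\<close>

definition Weyl :: "complex poly poly ring" where
  "Weyl = diff_op_ring UNIV pderiv"

definition weyl_const :: "complex \<Rightarrow> complex poly poly" where
  "weyl_const c = [:[:c:]:]"

definition weyl_x :: "complex poly poly" where
  "weyl_x = [:[:0, 1:]:]"

definition weyl_d :: "complex poly poly" where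
  "weyl_d = [:0, 1:]"

text \<open>The image of \<open>P = \<Sum> c\<^sub>i\<^sub>j x\<^sup>i \<partial>\<^sup>j\<close> under the morphism of \<open>\<complex>\<close>-algebras from the Weyl algebra to
  \<open>B\<close> with \<open>x \<mapsto> u\<close> and \<open>\<partial> \<mapsto> v\<close>; the map \<open>\<iota> : \<complex> \<rightarrow> B\<close> is the structure map of \<open>B\<close>. It is a
  morphism when \<open>v u - u v = 1\<close>.\<close>

definition weyl_eval ::
    "('b, 't) ring_scheme \<Rightarrow> (complex \<Rightarrow> 'b) \<Rightarrow> 'b \<Rightarrow> 'b \<Rightarrow> complex poly poly \<Rightarrow> 'b" where
  "weyl_eval B \<iota> u v P =
     (\<Oplus>\<^bsub>B\<^esub>j\<in>{..degree P}. \<Oplus>\<^bsub>B\<^esub>i\<in>{..degree (coeff P j)}.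
        \<iota> (coeff (coeff P j) i) \<otimes>\<^bsub>B\<^esub> u [^]\<^bsub>B\<^esub> i \<otimes>\<^bsub>B\<^esub> v [^]\<^bsub>B\<^esub> j)"

definition holonomic :: "(complex poly poly, 'm, 'c) module_scheme \<Rightarrow> bool" where
  "holonomic M \<longleftrightarrow>
     left_module Weyl M \<and> finitely_generated_module Weyl M \<and>
     (\<forall>m\<in>carrier M. \<exists>P\<in>carrier Weyl. P \<noteq> \<zero>\<^bsub>Weyl\<^esub> \<and> P \<odot>\<^bsub>M\<^esub> m = \<zero>\<^bsub>M\<^esub>)"

text \<open>The ring \<open>\<complex>{\<eta>}\<langle>\<partial>\<^sub>\<eta>\<rangle>\<close>.\<close>

definition conv_diff_ops :: "complex fps poly ring" where
  "conv_diff_ops = diff_op_ring {a. fps_conv_radius a > 0} fps_deriv"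

text \<open>The field \<open>\<complex>{t\<^sup>-\<^sup>1}[t]\<close>, realised as convergent Laurent series in the variable \<open>t\<^sup>-\<^sup>1\<close>: the
  coefficient of \<open>t\<^sup>i\<close> in \<open>f\<close> is \<open>fls_nth f (- i)\<close>.\<close>

definition conv_laurent :: "complex fls ring" where
  "conv_laurent =
     \<lparr>carrier = {f. fls_conv_radius f > 0}, monoid.mult = (*), one = 1, ring.zero = 0, ring.add = (+)\<rparr>"


section \<open>The ring of microdifferential operators at infinity\<close>

text \<open>A formal sum \<open>\<Sum>\<^sub>i a\<^sub>i(\<eta>) t\<^sup>i\<close> is encoded as the function \<open>i \<mapsto> a\<^sub>i\<close>.\<close>

type_synonym fsum = "int \<Rightarrow> complex fps"

definition sup_norm :: "real \<Rightarrow> complex fps \<Rightarrow> real" where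
  "sup_norm \<rho> a = (SUP z\<in>cball 0 \<rho>. norm (eval_fps a z))"

definition micro_carrier :: "fsum set" where
  "micro_carrier =
     {P. (\<exists>r. \<forall>i>r. P i = 0) \<and>
         (\<exists>\<rho>\<^sub>0>0. (\<forall>i. ereal \<rho>\<^sub>0 \<le> fps_conv_radius (P i)) \<and>
            (\<exists>\<rho> \<theta>. 0 < \<rho> \<and> \<rho> < \<rho>\<^sub>0 \<and> 0 < \<theta> \<and>
               summable (\<lambda>k. sup_norm \<rho> (P (- int k)) * (\<theta> ^ k / fact k))))}"

definition d_t :: "fsum \<Rightarrow> fsum" where
  "d_t P = (\<lambda>i. of_int (i + 1) * P (i + 1))"

definition d_eta :: "fsum \<Rightarrow> fsum" where
  "d_eta P = (\<lambda>i. fps_deriv (P i))"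

text \<open>Both \<^const>\<open>Sum_any\<close> below have finitely many nonzero terms for formal sums that are
  bounded above in \<open>t\<close>.\<close>

definition comm_mult :: "fsum \<Rightarrow> fsum \<Rightarrow> fsum" where
  "comm_mult P Q = (\<lambda>n. Sum_any (\<lambda>i. P i * Q (n - i)))"

definition micro_mult :: "fsum \<Rightarrow> fsum \<Rightarrow> fsum" where
  "micro_mult P Q =
     (\<lambda>n. Sum_any (\<lambda>\<alpha>::nat. fps_const (1 / fact \<alpha>) * comm_mult ((d_t ^^ \<alpha>) P) ((d_eta ^^ \<alpha>) Q) n))"

definition micro_monom :: "complex fps \<Rightarrow> int \<Rightarrow> fsum" where
  "micro_monom a i = (\<lambda>j. if j = i then a else 0)"

definition Micro :: "fsum ring" where
  "Micro =
     \<lparr>carrier = micro_carrier, monoid.mult = micro_mult, one = micro_monom 1 0,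
      ring.zero = (\<lambda>_. 0), ring.add = (\<lambda>P Q i. P i + Q i)\<rparr>"

definition micro_const :: "complex \<Rightarrow> fsum" where
  "micro_const c = micro_monom (fps_const c) 0"

definition micro_eta :: fsum where
  "micro_eta = micro_monom fps_X 0"

definition micro_t :: fsum where
  "micro_t = micro_monom 1 1"

definition micro_minus_t :: fsum where
  "micro_minus_t = micro_monom (- 1) 1"

text \<open>The morphism \<open>\<complex>{\<eta>}\<langle>\<partial>\<^sub>\<eta>\<rangle> \<rightarrow> \<E>\<close> with \<open>\<partial>\<^sub>\<eta> \<mapsto> t\<close>, and the inclusion \<open>\<complex>{t\<^sup>-\<^sup>1}[t] \<subseteq> \<E>\<close>.\<close>

definition micro_of_diff_op :: "complex fps poly \<Rightarrow> fsum" where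
  "micro_of_diff_op P = (\<lambda>i. if i \<ge> 0 then coeff P (nat i) else 0)"

definition micro_of_laurent :: "complex fls \<Rightarrow> fsum" where
  "micro_of_laurent f = (\<lambda>i. fps_const (fls_nth f (- i)))"


section \<open>Fourier transform and microlocalizations\<close>

definition fourier_hom :: "complex poly poly \<Rightarrow> complex poly poly" where
  "fourier_hom = weyl_eval Weyl weyl_const (- weyl_d) weyl_x"

definition fourier ::
    "(complex poly poly, 'm, 'c) module_scheme
      \<Rightarrow> (complex poly poly, (complex poly poly \<times> 'm \<Rightarrow>\<^sub>0 int) set) module" where
  "fourier M = extend_scalars Weyl Weyl fourier_hom M"

definition fourier_elem ::
    "(complex poly poly, 'm, 'c) module_scheme \<Rightarrow> 'm \<Rightarrow> (complex poly poly \<times> 'm \<Rightarrow>\<^sub>0 int) set" where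
  "fourier_elem M m = pure_tensor Weyl Weyl fourier_hom M \<one>\<^bsub>Weyl\<^esub> m"

definition micro_hom_t :: "complex poly poly \<Rightarrow> fsum" where
  "micro_hom_t = weyl_eval Micro micro_const micro_minus_t micro_eta"

definition micro_hom_eta :: "complex poly poly \<Rightarrow> fsum" where
  "micro_hom_eta = weyl_eval Micro micro_const micro_eta micro_t"

definition Micro_mod ::
    "(complex poly poly, 'm, 'c) module_scheme \<Rightarrow> (fsum, (fsum \<times> 'm \<Rightarrow>\<^sub>0 int) set) module" where
  "Micro_mod M = extend_scalars Weyl Micro micro_hom_t M"

definition mu ::
    "(complex poly poly, 'n, 'c) module_scheme \<Rightarrow> (fsum, (fsum \<times> 'n \<Rightarrow>\<^sub>0 int) set) module" where
  "mu N = extend_scalars Weyl Micro micro_hom_eta N"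

text \<open>\<open>\<Upsilon>\<close> is additive on \<open>\<mu>(M\<^sup>^)\<close> and maps \<open>\<alpha> \<otimes> m\<^sup>^\<close> to \<open>\<alpha> \<otimes> m\<close>.\<close>

definition is_Upsilon ::
    "(complex poly poly, 'm, 'c) module_scheme
      \<Rightarrow> ((fsum \<times> (complex poly poly \<times> 'm \<Rightarrow>\<^sub>0 int) set \<Rightarrow>\<^sub>0 int) set \<Rightarrow> (fsum \<times> 'm \<Rightarrow>\<^sub>0 int) set)
      \<Rightarrow> bool" where
  "is_Upsilon M \<Upsilon> \<longleftrightarrow>
     \<Upsilon> \<in> extensional (carrier (mu (fourier M))) \<and>
     \<Upsilon> \<in> hom (add_monoid (mu (fourier M))) (add_monoid (Micro_mod M)) \<and>
     (\<forall>\<alpha>\<in>carrier Micro. \<forall>m\<in>carrier M.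
        \<Upsilon> (pure_tensor Weyl Micro micro_hom_eta (fourier M) \<alpha> (fourier_elem M m))
          = pure_tensor Weyl Micro micro_hom_t M \<alpha> m)"


section \<open>Basic facts about the scalar rings\<close>

lemma partial_lmult_add:
  assumes "\<And>a b. \<delta> (a + b) = \<delta> a + \<delta> b" "\<delta> 0 = 0"
  shows "partial_lmult \<delta> (P + Q) = partial_lmult \<delta> P + partial_lmult \<delta> Q"
  by (rule poly_eqI) (simp add: partial_lmult_def coeff_map_poly assms coeff_pCons split: nat.split)

lemma coeff_partial_lmult:
  assumes "\<delta> 0 = 0"
  shows "coeff (partial_lmult \<delta> Q) n = (case n of 0 \<Rightarrow> 0 | Suc m \<Rightarrow> coeff Q m) + \<delta> (coeff Q n)"
  by (simp add: partial_lmult_def coeff_map_poly assms coeff_pCons split: nat.split)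

locale derivation_on =
  fixes K :: "'k::comm_ring_1 set" and \<delta> :: "'k \<Rightarrow> 'k"
  assumes K0: "0 \<in> K" and K1: "1 \<in> K"
    and Kadd: "\<And>a b. a \<in> K \<Longrightarrow> b \<in> K \<Longrightarrow> a + b \<in> K"
    and Kneg: "\<And>a. a \<in> K \<Longrightarrow> - a \<in> K"
    and Kmult: "\<And>a b. a \<in> K \<Longrightarrow> b \<in> K \<Longrightarrow> a * b \<in> K"
    and Kder: "\<And>a. a \<in> K \<Longrightarrow> \<delta> a \<in> K"
    and der_add: "\<And>a b. \<delta> (a + b) = \<delta> a + \<delta> b"
    and der_mult: "\<And>a b. \<delta> (a * b) = \<delta> a * b + a * \<delta> b"
begin

lemma der_0: "\<delta> 0 = 0" using der_add[of 0 0] by simp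
lemma der_1: "\<delta> 1 = 0" using der_mult[of 1 1] by simp

abbreviation "D \<equiv> partial_lmult \<delta>"
abbreviation "mul \<equiv> diff_op_mult \<delta>"

lemma D_add: "D (P + Q) = D P + D Q" by (rule partial_lmult_add[OF der_add der_0])
lemma D_0: "D 0 = 0" using D_add[of 0 0] by simp
lemma Dn_add: "(D ^^ i) (P + Q) = (D ^^ i) P + (D ^^ i) Q"
  by (induction i) (simp_all add: D_add)
lemma Dn_0: "(D ^^ i) 0 = 0" by (induction i) (simp_all add: D_0)
lemma D_smult: "D (Polynomial.smult a P) = Polynomial.smult (\<delta> a) P + Polynomial.smult a (D P)"
  by (rule poly_eqI) (simp add: coeff_partial_lmult der_0 der_mult algebra_simps split: nat.split)

lemma mul_alt: assumes "degree P \<le> n"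
  shows "mul P Q = (\<Sum>i\<le>n. Polynomial.smult (coeff P i) ((D ^^ i) Q))"
  unfolding diff_op_mult_def
  by (rule sum.mono_neutral_left) (use assms in \<open>auto simp: coeff_eq_0\<close>)

lemma sum_smult: "Polynomial.smult a (sum f A) = (\<Sum>i\<in>A. Polynomial.smult a (f i))"
  by (induction A rule: infinite_finite_induct) (simp_all add: smult_add_right)

lemma mul_add_left: "mul (P + P') Q = mul P Q + mul P' Q"
proof -
  define n where "n = max (degree P) (degree P')"
  have "degree (P + P') \<le> n" unfolding n_def by (rule degree_add_le_max)
  then show ?thesis
    by (simp add: mul_alt[of _ n] n_def smult_add_left sum.distrib)
qed

lemma mul_add_right: "mul P (Q + Q') = mul P Q + mul P Q'"
  by (simp add: diff_op_mult_def Dn_add smult_add_right sum.distrib)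

lemma mul_0_left: "mul 0 Q = 0" by (simp add: diff_op_mult_def)
lemma mul_0_right: "mul P 0 = 0" by (simp add: diff_op_mult_def Dn_0)

lemma mul_smult: "mul (Polynomial.smult a P) Q = Polynomial.smult a (mul P Q)"
proof -
  have "degree (Polynomial.smult a P) \<le> degree P" by (rule degree_smult_le)
  then have "mul (Polynomial.smult a P) Q
      = (\<Sum>i\<le>degree P. Polynomial.smult (coeff (Polynomial.smult a P) i) ((D ^^ i) Q))"
    by (rule mul_alt)
  then show ?thesis
    by (simp add: diff_op_mult_def[of \<delta> P Q] sum_smult)
qed

lemma mul_pCons_0: "mul (pCons 0 P) Q = mul P (D Q)"
proof -
  have "degree (pCons 0 P) \<le> Suc (degree P)" by (rule degree_pCons_le)
  then have "mul (pCons 0 P) Q = (\<Sum>i\<le>Suc (degree P). Polynomial.smult (coeff (pCons 0 P) i) ((D ^^ i) Q))"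
    by (rule mul_alt)
  also have "\<dots> = (\<Sum>i\<le>degree P. Polynomial.smult (coeff P i) ((D ^^ Suc i) Q))"
    by (subst sum.atMost_Suc_shift) simp
  also have "\<dots> = mul P (D Q)"
    by (simp add: diff_op_mult_def funpow_Suc_right del: funpow.simps)
  finally show ?thesis .
qed

lemma D_sum: "D (sum f A) = (\<Sum>i\<in>A. D (f i))"
  by (induction A rule: infinite_finite_induct) (simp_all add: D_0 D_add)

lemma D_mul: "D (mul P Q) = mul (D P) Q"
proof -
  have 1: "degree (map_poly \<delta> P) \<le> degree P" by (rule degree_le) (simp add: coeff_map_poly der_0 coeff_eq_0)
  have "D (mul P Q) = (\<Sum>i\<le>degree P. Polynomial.smult (\<delta> (coeff P i)) ((D ^^ i) Q))
      + (\<Sum>i\<le>degree P. Polynomial.smult (coeff P i) (D ((D ^^ i) Q)))"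
    by (simp add: diff_op_mult_def D_sum D_smult sum.distrib)
  also have "\<dots> = mul (map_poly \<delta> P) Q + mul (pCons 0 P) Q"
    using 1 by (simp add: mul_alt[of "map_poly \<delta> P" "degree P"] mul_pCons_0 coeff_map_poly der_0)
      (simp add: diff_op_mult_def funpow_swap1)
  finally show ?thesis by (simp add: partial_lmult_def mul_add_left add.commute)
qed

lemma Dn_mul: "(D ^^ i) (mul P Q) = mul ((D ^^ i) P) Q"
  by (induction i) (simp_all add: D_mul)

lemma mul_sum_left: "mul (sum f A) Q = (\<Sum>i\<in>A. mul (f i) Q)"
  by (induction A rule: infinite_finite_induct) (simp_all add: mul_0_left mul_add_left)

lemma mul_assoc: "mul (mul P Q) S = mul P (mul Q S)"
proof -
  have "mul (mul P Q) S = (\<Sum>i\<le>degree P. Polynomial.smult (coeff P i) (mul ((D ^^ i) Q) S))"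
    unfolding diff_op_mult_def[of \<delta> P Q] by (simp add: mul_sum_left mul_smult)
  also have "\<dots> = mul P (mul Q S)"
    unfolding diff_op_mult_def[of \<delta> P "mul Q S"] by (simp add: Dn_mul)
  finally show ?thesis .
qed

lemma mul_1_left: "mul 1 Q = Q"
  by (simp add: diff_op_mult_def)

lemma Dn_1: "(D ^^ i) 1 = Polynomial.monom 1 i"
proof (induction i)
  case (Suc i)
  have "map_poly \<delta> (Polynomial.monom 1 i) = 0"
    by (rule poly_eqI) (simp add: coeff_map_poly der_0 der_1)
  with Suc show ?case by (simp add: partial_lmult_def monom_Suc)
qed simp

lemma mul_1_right: "mul P 1 = P"
  by (simp add: diff_op_mult_def Dn_1 smult_monom poly_as_sum_of_monoms)

lemma sum_K: "(\<And>i. i \<in> A \<Longrightarrow> f i \<in> K) \<Longrightarrow> sum f A \<in> K"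
  by (induction A rule: infinite_finite_induct) (auto simp: K0 Kadd)

lemma Dn_K: "(\<And>i. coeff Q i \<in> K) \<Longrightarrow> coeff ((D ^^ j) Q) i \<in> K"
  by (induction j arbitrary: i)
    (auto simp: coeff_partial_lmult der_0 split: nat.split intro!: Kadd Kder K0)

lemma ring_diff_op_ring: "ring (diff_op_ring K \<delta>)"
proof (rule ringI)
  show "abelian_group (diff_op_ring K \<delta>)"
  proof (rule abelian_groupI)
    show "\<exists>y\<in>carrier (diff_op_ring K \<delta>). y \<oplus>\<^bsub>diff_op_ring K \<delta>\<^esub> x = \<zero>\<^bsub>diff_op_ring K \<delta>\<^esub>"
      if "x \<in> carrier (diff_op_ring K \<delta>)" for x
      by (rule bexI[of _ "- x"]) (use that in \<open>auto simp: diff_op_ring_def Kneg\<close>)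
  qed (auto simp: diff_op_ring_def K0 Kadd)
  show "Group.monoid (diff_op_ring K \<delta>)"
    by (rule monoidI)
      (auto simp: diff_op_ring_def mul_1_left mul_1_right mul_assoc K0 K1 coeff_1,
       auto simp: diff_op_mult_def coeff_sum intro!: sum_K Kmult Dn_K)
qed (auto simp: diff_op_ring_def mul_add_left mul_add_right)

end

lemma ring_Weyl: "ring Weyl"
  unfolding Weyl_def
  by (rule derivation_on.ring_diff_op_ring) (unfold_locales, auto simp: pderiv_add pderiv_mult)

lemma Weyl_commutator:
  "weyl_d \<otimes>\<^bsub>Weyl\<^esub> weyl_x = weyl_x \<otimes>\<^bsub>Weyl\<^esub> weyl_d \<oplus>\<^bsub>Weyl\<^esub> \<one>\<^bsub>Weyl\<^esub>"
  by (simp add: Weyl_def diff_op_ring_def diff_op_mult_def weyl_d_def weyl_x_def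
      partial_lmult_def map_poly_pCons pderiv_pCons one_pCons)

lemma ring_conv_diff_ops: "ring conv_diff_ops"
  unfolding conv_diff_ops_def
proof (rule derivation_on.ring_diff_op_ring, unfold_locales)
  fix a b :: "complex fps"
  show "a \<in> {a. 0 < fps_conv_radius a} \<Longrightarrow> b \<in> {a. 0 < fps_conv_radius a} \<Longrightarrow> a + b \<in> {a. 0 < fps_conv_radius a}"
    using fps_conv_radius_add[of a b] by (auto simp: min_def split: if_splits intro: less_le_trans)
  show "a \<in> {a. 0 < fps_conv_radius a} \<Longrightarrow> b \<in> {a. 0 < fps_conv_radius a} \<Longrightarrow> a * b \<in> {a. 0 < fps_conv_radius a}"
    using fps_conv_radius_mult[of a b] by (auto simp: min_def split: if_splits intro: less_le_trans)
  show "a \<in> {a. 0 < fps_conv_radius a} \<Longrightarrow> fps_deriv a \<in> {a. 0 < fps_conv_radius a}"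
    using fps_conv_radius_deriv[of a] by (auto intro: less_le_trans)
qed (auto simp: algebra_simps)

lemma field_conv_laurent: "field conv_laurent"
proof -
  have pos: "0 < fls_conv_radius (inverse f)" if "0 < fls_conv_radius f" for f
  proof (cases "f = 0")
    case False
    have "0 < fps_conv_radius (inverse (fls_base_factor_to_fps f))"
      by (rule fps_conv_radius_inverse_pos) (use that False in \<open>simp_all add: fls_conv_radius_altdef\<close>)
    then show ?thesis by (simp add: fls_inverse_def)
  qed simp
  have a: "0 < fls_conv_radius (f + g)" "0 < fls_conv_radius (f * g)"
    if "0 < fls_conv_radius f" "0 < fls_conv_radius g" for f g
    using that fls_conv_radius_add[of f g] fls_conv_radius_mult[of f g]
    by (auto simp: min_def split: if_splits intro: less_le_trans)
  have "cring conv_laurent"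
  proof (rule cringI)
    show "abelian_group conv_laurent"
    proof (rule abelian_groupI)
      show "\<exists>y\<in>carrier conv_laurent. y \<oplus>\<^bsub>conv_laurent\<^esub> x = \<zero>\<^bsub>conv_laurent\<^esub>"
        if "x \<in> carrier conv_laurent" for x
        by (rule bexI[of _ "- x"]) (use that in \<open>auto simp: conv_laurent_def\<close>)
    qed (auto simp: conv_laurent_def a)
    show "Group.comm_monoid conv_laurent"
      by (rule comm_monoidI) (auto simp: conv_laurent_def a)
  qed (auto simp: conv_laurent_def algebra_simps)
  then interpret cring conv_laurent .
  show ?thesis
  proof (rule cring_fieldI2)
    show "\<exists>b\<in>carrier conv_laurent. x \<otimes>\<^bsub>conv_laurent\<^esub> b = \<one>\<^bsub>conv_laurent\<^esub>"
      if "x \<in> carrier conv_laurent" "x \<noteq> \<zero>\<^bsub>conv_laurent\<^esub>" for x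
      by (rule bexI[of _ "inverse x"]) (use that in \<open>auto simp: conv_laurent_def pos\<close>)
  qed (auto simp: conv_laurent_def)
qed

lemma Sum_any_single: "(\<And>x. x \<noteq> a \<Longrightarrow> f x = 0) \<Longrightarrow> Sum_any f = f a"
proof -
  assume a: "\<And>x. x \<noteq> a \<Longrightarrow> f x = 0"
  then have "{x. f x \<noteq> 0} \<subseteq> {a}" by auto
  then have "Sum_any f = sum f {a}" by (intro Sum_any.expand_superset) auto
  then show ?thesis by simp
qed

lemma comm_mult_monom: "comm_mult (micro_monom a i) Q = (\<lambda>n. a * Q (n - i))"
  unfolding comm_mult_def by (rule ext, subst Sum_any_single[of i]) (auto simp: micro_monom_def)

lemma micro_commutator:
  "micro_mult micro_t micro_eta = (\<lambda>n. micro_mult micro_eta micro_t n + micro_monom 1 0 n)"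
proof -
  have z: "comm_mult (\<lambda>_. 0) Q = (\<lambda>_. 0)" for Q by (simp add: comm_mult_def)
  have t1: "d_t micro_t = micro_monom 1 0" by (auto simp: d_t_def micro_t_def micro_monom_def)
  have t2: "d_t (micro_monom a 0) = (\<lambda>_. 0)" for a
    by (rule ext) (simp add: d_t_def micro_monom_def eq_neg_iff_add_eq_0[symmetric])
  have t3: "d_t (\<lambda>_. 0) = (\<lambda>_. 0)" by (auto simp: d_t_def)
  have t4: "(d_t ^^ k) (\<lambda>_. 0) = (\<lambda>_. 0)" for k by (induction k) (auto simp: t3)
  have A: "(d_t ^^ (Suc (Suc k))) micro_t = (\<lambda>_. 0)" for k
    by (simp add: t1 t2 t4 funpow_Suc_right del: funpow.simps)
  have B: "(d_t ^^ (Suc k)) micro_eta = (\<lambda>_. 0)" for k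
    by (simp add: t2 t4 micro_eta_def funpow_Suc_right del: funpow.simps)
  have e: "d_eta micro_eta = micro_monom 1 0" by (auto simp: d_eta_def micro_eta_def micro_monom_def)
  have 1: "micro_mult micro_eta micro_t = micro_monom fps_X 1"
    unfolding micro_mult_def
    apply (rule ext, subst Sum_any_single[of 0])
    subgoal for n x by (cases x) (simp_all add: B z del: funpow.simps)
    by (simp add: micro_eta_def comm_mult_monom micro_t_def) (auto simp: micro_monom_def)
  have 2: "micro_mult micro_t micro_eta n = micro_monom fps_X 1 n + micro_monom 1 0 n" for n
  proof -
    let ?f = "\<lambda>\<alpha>::nat. fps_const (1 / fact \<alpha>) * comm_mult ((d_t ^^ \<alpha>) micro_t) ((d_eta ^^ \<alpha>) micro_eta) n"
    have "Sum_any ?f = sum ?f {0,1}"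
    proof (rule Sum_any.expand_superset)
      show "{a. ?f a \<noteq> 0} \<subseteq> {0,1}"
      proof
        fix a assume "a \<in> {a. ?f a \<noteq> 0}"
        then show "a \<in> {0,1}"
          apply (cases a; simp del: funpow.simps)
          subgoal for k by (cases k) (auto simp add: A z simp del: funpow.simps)
          done
      qed
    qed simp
    moreover have "comm_mult micro_t Q = (\<lambda>n. Q (n - 1))" for Q
      by (simp add: micro_t_def comm_mult_monom)
    ultimately have "micro_mult micro_t micro_eta n = micro_eta (n - 1) + micro_monom 1 0 n"
      by (simp add: micro_mult_def t1 e comm_mult_monom)
    then show ?thesis by (simp add: micro_eta_def micro_monom_def)
  qed
  show ?thesis by (auto simp: 1 2)
qed

end

theory Submission
  imports Defs
begin

text \<open>The composite of the Fourier morphism with \<open>W\<^sub>\<eta> \<rightarrow> \<E>\<close>, \<open>\<eta> \<mapsto> \<eta>\<close>, \<open>\<partial>\<^sub>\<eta> \<mapsto> t\<close>, sends \<open>t\<close> to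
  \<open>-t\<close> and \<open>\<partial>\<^sub>t\<close> to \<open>\<eta>\<close>, so that \<open>\<Upsilon>\<close> is the isomorphism
  \<open>B \<otimes>\<^bsub>A'\<^esub> (A' \<otimes>\<^bsub>A\<^esub> M) \<cong> B \<otimes>\<^bsub>A\<^esub> M\<close> expressing the transitivity of extension of scalars. The analytic
  input is that \<open>\<E>\<close> is a ring. On the coefficients of a fixed power of \<open>t\<close> all sums in the product are
  finite, and associativity becomes the Leibniz rule together with Vandermonde's identity for generalised
  binomial coefficients. Stability under products follows from a description of \<open>\<E>\<close> by bounds
  \<open>A\<^bsup>k+m+1\<^esup> k!\<close> on the Taylor coefficients, which is equivalent to the given one by Cauchy's
  inequalities.\<close>

section \<open>Extension of scalars\<close>

text \<open>Elements of a tensor product are cosets here, so no map out of one is given by a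
  formula: maps come from the universal property, and identities between them are checked on
  generators. The elements \<alpha> \<otimes> (1 \<otimes> m) suffice because \<alpha> \<otimes> (a
  \<otimes> m) equals \<alpha> h(a) \<otimes> (1 \<otimes> m), where h maps W_eta to E and must be
  multiplicative. To see that it is, h is factored: evaluating a normally ordered element needs no
  reordering, so h is the inclusion of polynomial into power series coefficients followed by the
  embedding of differential operators into E. The factorial in the growth condition is what products
  require: a term with \<alpha> derivatives costs \<alpha>!, and \<alpha>! i! j! is at most
  (\<alpha> + i + j)!, exactly the factorial allowed for the coefficient to which the term
  contributes. All other losses are exponential and enter the constant. Linearity is proved over E
  itself; both structures in the statement then arise by restricting scalars along ring
  homomorphisms into E.\<close>

lemma keys_diff_subset:
  "Poly_Mapping.keys x \<subseteq> S \<Longrightarrow> Poly_Mapping.keys y \<subseteq> S \<Longrightarrow> Poly_Mapping.keys (x - y) \<subseteq> S"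
  using keys_diff[of x y] by blast

lemma keys_add_subset:
  "Poly_Mapping.keys x \<subseteq> S \<Longrightarrow> Poly_Mapping.keys y \<subseteq> S \<Longrightarrow> Poly_Mapping.keys (x + y) \<subseteq> S"
  using Poly_Mapping.keys_add[of x y] by blast

text \<open>The right action b h(a) enters only through the balancing relations, so the construction
  asks of \<open>h\<close> just that its values lie in \<open>B\<close>. Multiplicativity is imposed
  later, on the map along which scalars are moved.\<close>

locale scalar_extension = B: ring B + M: left_module A M
  for A :: "('a, 's) ring_scheme" and B :: "('b, 't) ring_scheme"
    and h :: "'a \<Rightarrow> 'b" and M :: "('a, 'm, 'c) module_scheme" +
  assumes h_closed: "a \<in> carrier A \<Longrightarrow> h a \<in> carrier B"
begin

abbreviation "F \<equiv> tensor_free B M"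
abbreviation "N \<equiv> tensor_null A B h M"
abbreviation "cls \<equiv> tensor_class A B h M"
abbreviation "T \<equiv> extend_scalars A B h M"
abbreviation "pt \<equiv> pure_tensor A B h M"
abbreviation "left_mult b \<equiv> frag_extend (\<lambda>(b', m). frag_of (b \<otimes>\<^bsub>B\<^esub> b', m))"

lemma group_F: "group F" and comm_group_F: "comm_group F"
  by (simp_all add: tensor_free_def abelian_free_Abelian_group)

lemma F_simps [simp]: "x \<otimes>\<^bsub>F\<^esub> y = x + y" "\<one>\<^bsub>F\<^esub> = 0"
  "x \<in> carrier F \<longleftrightarrow> Poly_Mapping.keys x \<subseteq> carrier B \<times> carrier M"
  by (simp_all add: tensor_free_def)

lemma F_inv: "x \<in> carrier F \<Longrightarrow> inv\<^bsub>F\<^esub> x = - x"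
  by (simp add: tensor_free_def)

lemma relations_closed: "tensor_relations A B h M \<subseteq> carrier F"
proof
  fix x assume "x \<in> tensor_relations A B h M"
  then show "x \<in> carrier F"
    unfolding tensor_relations_def F_simps
    by (elim UnE CollectE exE conjE; hypsubst) (intro keys_diff_subset; simp add: h_closed)+
qed

lemma subgroup_N: "subgroup N F"
  unfolding tensor_null_def by (rule group.generate_is_subgroup[OF group_F relations_closed])

lemma normal_N: "N \<lhd> F"
  using comm_group.normal_iff_subgroup[OF comm_group_F] subgroup_N by blast

lemma N_zero: "0 \<in> N" and N_add: "x \<in> N \<Longrightarrow> y \<in> N \<Longrightarrow> x + y \<in> N"
  and N_closed: "x \<in> N \<Longrightarrow> x \<in> carrier F"
  using subgroup.one_closed[OF subgroup_N] subgroup.m_closed[OF subgroup_N]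
    subgroup.mem_carrier[OF subgroup_N] by auto

lemma N_minus: "x \<in> N \<Longrightarrow> - x \<in> N"
  using subgroup.m_inv_closed[OF subgroup_N] F_inv N_closed by fastforce

lemma N_diff: "x \<in> N \<Longrightarrow> y \<in> N \<Longrightarrow> x - y \<in> N"
  using N_add[OF _ N_minus] by fastforce

lemma N_rel: "x \<in> tensor_relations A B h M \<Longrightarrow> x \<in> N"
  unfolding tensor_null_def by (rule generate.incl)

lemma mem_cls_iff: "x \<in> cls c \<longleftrightarrow> x - c \<in> N"
  unfolding tensor_class_def r_coset_def by (auto intro!: bexI[of _ "x - c"])

lemma cls_eq_iff: "cls a = cls b \<longleftrightarrow> a - b \<in> N"
proof
  assume "cls a = cls b"
  then show "a - b \<in> N" using mem_cls_iff[of a a] mem_cls_iff[of a b] N_zero by simp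
next
  assume d: "a - b \<in> N"
  have "x - a \<in> N \<longleftrightarrow> x - b \<in> N" for x
    using N_add[of "x - a" "a - b"] N_diff[of "x - b" "a - b"] d by auto
  then show "cls a = cls b" by (auto simp: mem_cls_iff)
qed

lemma carrier_T: "carrier T = cls ` carrier F"
  by (auto simp: extend_scalars_def FactGroup_def RCOSETS_def tensor_class_def Let_def)

lemma add_cls: "a \<in> carrier F \<Longrightarrow> b \<in> carrier F \<Longrightarrow> cls a \<oplus>\<^bsub>T\<^esub> cls b = cls (a + b)"
  using normal.rcos_sum[OF normal_N, of a b]
  by (simp add: extend_scalars_def FactGroup_def tensor_class_def Let_def)

lemma zero_cls: "\<zero>\<^bsub>T\<^esub> = cls 0"
  by (auto simp: extend_scalars_def FactGroup_def Let_def mem_cls_iff)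

lemma T_cases: assumes "x \<in> carrier T" obtains c where "c \<in> carrier F" "x = cls c"
  using assms unfolding carrier_T by blast

lemma F_induct [consumes 1, case_names zero diff pure]:
  assumes "c \<in> carrier F" "P 0"
    and "\<And>x y. x \<in> carrier F \<Longrightarrow> y \<in> carrier F \<Longrightarrow> P x \<Longrightarrow> P y \<Longrightarrow> P (x - y)"
    and "\<And>b m. b \<in> carrier B \<Longrightarrow> m \<in> carrier M \<Longrightarrow> P (frag_of (b, m))"
  shows "P c"
  using assms by (intro free_Abelian_group_induct[of c "carrier B \<times> carrier M" P]) auto

lemma left_mult_closed:
  assumes "b \<in> carrier B" "c \<in> carrier F" shows "left_mult b c \<in> carrier F"
proof -
  have "Poly_Mapping.keys (left_mult b c)
      \<subseteq> (\<Union>x\<in>Poly_Mapping.keys c. Poly_Mapping.keys ((\<lambda>(b', m). frag_of (b \<otimes>\<^bsub>B\<^esub> b', m)) x))"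
    by (rule keys_frag_extend)
  also have "\<dots> \<subseteq> carrier B \<times> carrier M" using assms by auto
  finally show ?thesis by simp
qed

text \<open>Left multiplication commutes with right multiplication by h(a) and leaves the second
  factor alone, so it maps each of the three families of relations into itself. This makes scalar
  multiplication well defined on cosets.\<close>

lemma left_mult_relations:
  assumes b: "b \<in> carrier B" and x: "x \<in> tensor_relations A B h M"
  shows "left_mult b x \<in> tensor_relations A B h M"
proof -
  consider (1) c d m where "x = frag_of (c \<oplus>\<^bsub>B\<^esub> d, m) - frag_of (c, m) - frag_of (d, m)"
      "c \<in> carrier B" "d \<in> carrier B" "m \<in> carrier M"
    | (2) c m n where "x = frag_of (c, m \<oplus>\<^bsub>M\<^esub> n) - frag_of (c, m) - frag_of (c, n)"
      "c \<in> carrier B" "m \<in> carrier M" "n \<in> carrier M"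
    | (3) a c m where "x = frag_of (c \<otimes>\<^bsub>B\<^esub> h a, m) - frag_of (c, a \<odot>\<^bsub>M\<^esub> m)"
      "a \<in> carrier A" "c \<in> carrier B" "m \<in> carrier M"
    using x unfolding tensor_relations_def by blast
  then show ?thesis
  proof cases
    case 1
    then have "left_mult b x = frag_of ((b \<otimes>\<^bsub>B\<^esub> c) \<oplus>\<^bsub>B\<^esub> (b \<otimes>\<^bsub>B\<^esub> d), m) - frag_of (b \<otimes>\<^bsub>B\<^esub> c, m) - frag_of (b \<otimes>\<^bsub>B\<^esub> d, m)"
      using b by (simp add: frag_extend_diff B.r_distr)
    then show ?thesis unfolding tensor_relations_def using 1 b by blast
  next
    case 2
    then have "left_mult b x = frag_of (b \<otimes>\<^bsub>B\<^esub> c, m \<oplus>\<^bsub>M\<^esub> n) - frag_of (b \<otimes>\<^bsub>B\<^esub> c, m) - frag_of (b \<otimes>\<^bsub>B\<^esub> c, n)"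
      by (simp add: frag_extend_diff)
    then show ?thesis unfolding tensor_relations_def using 2 b by blast
  next
    case 3
    then have "left_mult b x = frag_of ((b \<otimes>\<^bsub>B\<^esub> c) \<otimes>\<^bsub>B\<^esub> h a, m) - frag_of (b \<otimes>\<^bsub>B\<^esub> c, a \<odot>\<^bsub>M\<^esub> m)"
      using b h_closed by (simp add: frag_extend_diff B.m_assoc)
    then show ?thesis unfolding tensor_relations_def using 3 b by blast
  qed
qed

lemma left_mult_N:
  assumes "b \<in> carrier B" "x \<in> N" shows "left_mult b x \<in> N"
  using assms(2) unfolding tensor_null_def
proof (induction rule: generate.induct)
  case one
  then show ?case using N_zero by (simp add: tensor_null_def)
next
  case (incl x)
  then show ?case by (intro generate.incl left_mult_relations assms)
next
  case (inv x)
  then have "inv\<^bsub>F\<^esub> x = - x" using relations_closed F_inv by blast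
  then show ?case
    using N_minus[OF N_rel[OF left_mult_relations[OF assms(1) inv]]]
    by (simp add: frag_extend_minus tensor_null_def)
next
  case (eng x y)
  then show ?case using N_add by (simp add: frag_extend_add tensor_null_def)
qed

lemma smult_cls:
  assumes "b \<in> carrier B"
  shows "b \<odot>\<^bsub>T\<^esub> cls c = cls (left_mult b c)"
proof -
  \<comment> \<open>Two representatives differ by an element of \<open>N\<close>, which left
    multiplication keeps in \<open>N\<close>; the union in the definition is therefore a union of
    copies of one class.\<close>
  have "cls (left_mult b d) = cls (left_mult b c)" if "d \<in> cls c" for d
    using left_mult_N[OF assms, of "d - c"] that by (simp add: cls_eq_iff mem_cls_iff frag_extend_diff)
  then have "(\<Union>d\<in>cls c. cls (left_mult b d)) = (\<Union>d\<in>cls c. cls (left_mult b c))"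
    by (rule SUP_cong[OF refl])
  also have "c \<in> cls c" by (simp add: mem_cls_iff N_zero)
  then have "(\<Union>d\<in>cls c. cls (left_mult b c)) = cls (left_mult b c)" by blast
  finally show ?thesis by (simp add: extend_scalars_def Let_def)
qed

lemma left_mult_left_mult:
  assumes "a \<in> carrier B" "b \<in> carrier B" "c \<in> carrier F"
  shows "left_mult a (left_mult b c) = left_mult (a \<otimes>\<^bsub>B\<^esub> b) c"
  using assms(3) by (induction c rule: F_induct) (use assms(1,2) in \<open>simp_all add: frag_extend_diff B.m_assoc\<close>)

lemma left_mult_one:
  assumes "c \<in> carrier F" shows "left_mult \<one>\<^bsub>B\<^esub> c = c"
  using assms by (induction c rule: F_induct) (simp_all add: frag_extend_diff)

text \<open>Associativity and the unit law already hold in the free group. Distributivity in the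
  scalar holds only modulo \<open>N\<close>: on a generator the defect is the first bilinearity
  relation.\<close>

lemma left_mult_add_N:
  assumes "a \<in> carrier B" "b \<in> carrier B" "c \<in> carrier F"
  shows "left_mult (a \<oplus>\<^bsub>B\<^esub> b) c - (left_mult a c + left_mult b c) \<in> N"
  using assms(3)
  proof (induction c rule: F_induct)
    case zero then show ?case by (simp add: N_zero)
  next
    case (diff x y)
    have "left_mult (a \<oplus>\<^bsub>B\<^esub> b) (x - y) - (left_mult a (x - y) + left_mult b (x - y))
       = (left_mult (a \<oplus>\<^bsub>B\<^esub> b) x - (left_mult a x + left_mult b x))
         - (left_mult (a \<oplus>\<^bsub>B\<^esub> b) y - (left_mult a y + left_mult b y))"
      by (simp add: frag_extend_diff)
    then show ?case using N_diff[OF diff(3,4)] by simp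
  next
    case (pure b' m)
    have "frag_of (a \<otimes>\<^bsub>B\<^esub> b' \<oplus>\<^bsub>B\<^esub> b \<otimes>\<^bsub>B\<^esub> b', m) - frag_of (a \<otimes>\<^bsub>B\<^esub> b', m) - frag_of (b \<otimes>\<^bsub>B\<^esub> b', m) \<in> N"
      by (rule N_rel) (unfold tensor_relations_def, use pure assms in blast)
    then show ?case using pure assms by (simp add: B.l_distr algebra_simps)
  qed

lemma cls_closed [simp, intro]: "c \<in> carrier F \<Longrightarrow> cls c \<in> carrier T"
  unfolding carrier_T by blast

lemma abelian_group_T: "abelian_group T"
proof (rule abelian_groupI)
  show "x \<oplus>\<^bsub>T\<^esub> y \<in> carrier T" if "x \<in> carrier T" "y \<in> carrier T" for x y
    using that by (elim T_cases) (simp add: add_cls keys_add_subset)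
  show "\<zero>\<^bsub>T\<^esub> \<in> carrier T" by (simp add: zero_cls)
  show "x \<oplus>\<^bsub>T\<^esub> y \<oplus>\<^bsub>T\<^esub> z = x \<oplus>\<^bsub>T\<^esub> (y \<oplus>\<^bsub>T\<^esub> z)"
    if "x \<in> carrier T" "y \<in> carrier T" "z \<in> carrier T" for x y z
    using that by (elim T_cases) (simp add: add_cls keys_add_subset add.assoc)
  show "x \<oplus>\<^bsub>T\<^esub> y = y \<oplus>\<^bsub>T\<^esub> x" if "x \<in> carrier T" "y \<in> carrier T" for x y
    using that by (elim T_cases) (simp add: add_cls add.commute)
  show "\<zero>\<^bsub>T\<^esub> \<oplus>\<^bsub>T\<^esub> x = x" if "x \<in> carrier T" for x
    using that by (elim T_cases) (simp add: add_cls zero_cls)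
  show "\<exists>y\<in>carrier T. y \<oplus>\<^bsub>T\<^esub> x = \<zero>\<^bsub>T\<^esub>" if x: "x \<in> carrier T" for x
  proof -
    obtain c where c: "c \<in> carrier F" "x = cls c" using x by (rule T_cases)
    then have "- c \<in> carrier F" by simp
    then show ?thesis using c by (intro bexI[of _ "cls (- c)"]) (auto simp: add_cls zero_cls)
  qed
qed

lemma left_module_T: "left_module B T"
proof (intro left_module.intro left_module_axioms.intro)
  show "ring B" by (rule B.ring_axioms)
  show "abelian_group T" by (rule abelian_group_T)
  show "\<one>\<^bsub>B\<^esub> \<odot>\<^bsub>T\<^esub> x = x" if "x \<in> carrier T" for x
    using that by (elim T_cases) (simp only: smult_cls[OF B.one_closed] left_mult_one)
  fix a x assume a: "a \<in> carrier B" and x: "x \<in> carrier T"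
  obtain c where c: "c \<in> carrier F" "x = cls c" using x by (rule T_cases)
  show "a \<odot>\<^bsub>T\<^esub> x \<in> carrier T"
    unfolding c(2) smult_cls[OF a] by (intro cls_closed left_mult_closed a c)
  show "a \<odot>\<^bsub>T\<^esub> (x \<oplus>\<^bsub>T\<^esub> y) = a \<odot>\<^bsub>T\<^esub> x \<oplus>\<^bsub>T\<^esub> a \<odot>\<^bsub>T\<^esub> y" if y: "y \<in> carrier T" for y
  proof -
    obtain d where d: "d \<in> carrier F" "y = cls d" using y by (rule T_cases)
    show ?thesis
      unfolding c(2) d(2) add_cls[OF c(1) d(1)] smult_cls[OF a] frag_extend_add
        add_cls[OF left_mult_closed[OF a c(1)] left_mult_closed[OF a d(1)]] ..
  qed
  fix b assume b: "b \<in> carrier B"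
  show "(a \<oplus>\<^bsub>B\<^esub> b) \<odot>\<^bsub>T\<^esub> x = a \<odot>\<^bsub>T\<^esub> x \<oplus>\<^bsub>T\<^esub> b \<odot>\<^bsub>T\<^esub> x"
    unfolding c(2) smult_cls[OF a] smult_cls[OF b] smult_cls[OF B.add.m_closed[OF a b]]
      add_cls[OF left_mult_closed[OF a c(1)] left_mult_closed[OF b c(1)]] cls_eq_iff
    by (rule left_mult_add_N[OF a b c(1)])
  show "(a \<otimes>\<^bsub>B\<^esub> b) \<odot>\<^bsub>T\<^esub> x = a \<odot>\<^bsub>T\<^esub> (b \<odot>\<^bsub>T\<^esub> x)"
    unfolding c(2) smult_cls[OF a] smult_cls[OF b] smult_cls[OF B.m_closed[OF a b]]
      left_mult_left_mult[OF a b c(1)] ..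
qed

section \<open>Pure tensors and the universal property\<close>

lemma pt_closed: "b \<in> carrier B \<Longrightarrow> m \<in> carrier M \<Longrightarrow> pt b m \<in> carrier T"
  by (simp add: pure_tensor_def)

lemma smult_pt: "a \<in> carrier B \<Longrightarrow> a \<odot>\<^bsub>T\<^esub> pt b m = pt (a \<otimes>\<^bsub>B\<^esub> b) m"
  by (simp add: pure_tensor_def smult_cls)

lemma pt_add_left:
  assumes "b \<in> carrier B" "c \<in> carrier B" "m \<in> carrier M"
  shows "pt (b \<oplus>\<^bsub>B\<^esub> c) m = pt b m \<oplus>\<^bsub>T\<^esub> pt c m"
proof -
  have "frag_of (b \<oplus>\<^bsub>B\<^esub> c, m) - frag_of (b, m) - frag_of (c, m) \<in> N"
    by (rule N_rel) (unfold tensor_relations_def, use assms in blast)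
  then show ?thesis using assms by (simp add: pure_tensor_def add_cls cls_eq_iff algebra_simps)
qed

lemma pt_add_right:
  assumes "b \<in> carrier B" "m \<in> carrier M" "n \<in> carrier M"
  shows "pt b (m \<oplus>\<^bsub>M\<^esub> n) = pt b m \<oplus>\<^bsub>T\<^esub> pt b n"
proof -
  have "frag_of (b, m \<oplus>\<^bsub>M\<^esub> n) - frag_of (b, m) - frag_of (b, n) \<in> N"
    by (rule N_rel) (unfold tensor_relations_def, use assms in blast)
  then show ?thesis using assms by (simp add: pure_tensor_def add_cls cls_eq_iff algebra_simps)
qed

lemma pt_balanced:
  assumes "a \<in> carrier A" "b \<in> carrier B" "m \<in> carrier M"
  shows "pt (b \<otimes>\<^bsub>B\<^esub> h a) m = pt b (a \<odot>\<^bsub>M\<^esub> m)"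
proof -
  have "frag_of (b \<otimes>\<^bsub>B\<^esub> h a, m) - frag_of (b, a \<odot>\<^bsub>M\<^esub> m) \<in> N"
    by (rule N_rel) (unfold tensor_relations_def, use assms in blast)
  then show ?thesis by (simp add: pure_tensor_def cls_eq_iff)
qed

text \<open>The uniqueness half of the universal property, and the means by which all later
  identities between additive maps are reduced to pure tensors.\<close>

lemma hom_eq_on_pt:
  assumes G: "group G" and g: "g \<in> hom (add_monoid T) G" and g': "g' \<in> hom (add_monoid T) G"
    and eq: "\<And>b m. b \<in> carrier B \<Longrightarrow> m \<in> carrier M \<Longrightarrow> g (pt b m) = g' (pt b m)"
    and x: "x \<in> carrier T"
  shows "g x = g' x"
proof -
  interpret T: abelian_group T by (rule abelian_group_T)
  interpret g: group_hom "add_monoid T" G g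
    using G g T.a_comm_group by (simp add: group_hom_def group_hom_axioms_def comm_group_def)
  interpret g': group_hom "add_monoid T" G g'
    using G g' T.a_comm_group by (simp add: group_hom_def group_hom_axioms_def comm_group_def)
  obtain c where c: "c \<in> carrier F" "x = cls c" using x by (rule T_cases)
  from c(1) have "g (cls c) = g' (cls c)"
  proof (induction c rule: F_induct)
    case zero
    then show ?case using g.hom_one g'.hom_one by (simp add: zero_cls)
  next
    case (diff x y)
    then have y: "y \<in> carrier F" and d: "x - y \<in> carrier F"
      by (simp_all add: keys_diff_subset)
    \<comment> \<open>The induction on the free group produces differences, whereas a homomorphism
      is known on sums; hence x is split as (x - y) + y and the value at y is cancelled.\<close>
    have "cls x = cls (x - y) \<oplus>\<^bsub>T\<^esub> cls y" using y d by (simp add: add_cls)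
    then have "g (cls x) = g (cls (x - y)) \<otimes>\<^bsub>G\<^esub> g (cls y)" "g' (cls x) = g' (cls (x - y)) \<otimes>\<^bsub>G\<^esub> g' (cls y)"
      using g.hom_mult[of "cls (x - y)" "cls y"] g'.hom_mult[of "cls (x - y)" "cls y"] y d
      by (simp_all del: F_simps(3))
    then have "g (cls (x - y)) \<otimes>\<^bsub>G\<^esub> g (cls y) = g' (cls (x - y)) \<otimes>\<^bsub>G\<^esub> g (cls y)"
      using diff by simp
    then show ?case
      using y d g.hom_closed[of "cls y"] g.hom_closed[of "cls (x - y)"] g'.hom_closed[of "cls (x - y)"]
      by (simp del: F_simps(3))
  next
    case (pure b m)
    then show ?case using eq unfolding pure_tensor_def by simp
  qed
  then show ?thesis by (simp add: c)
qed

lemma universal_property: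
  assumes G: "comm_group G"
    and closed: "\<And>b m. b \<in> carrier B \<Longrightarrow> m \<in> carrier M \<Longrightarrow> f b m \<in> carrier G"
    and add_left: "\<And>b c m. b \<in> carrier B \<Longrightarrow> c \<in> carrier B \<Longrightarrow> m \<in> carrier M
      \<Longrightarrow> f (b \<oplus>\<^bsub>B\<^esub> c) m = f b m \<otimes>\<^bsub>G\<^esub> f c m"
    and add_right: "\<And>b m n. b \<in> carrier B \<Longrightarrow> m \<in> carrier M \<Longrightarrow> n \<in> carrier M
      \<Longrightarrow> f b (m \<oplus>\<^bsub>M\<^esub> n) = f b m \<otimes>\<^bsub>G\<^esub> f b n"
    and balanced: "\<And>a b m. a \<in> carrier A \<Longrightarrow> b \<in> carrier B \<Longrightarrow> m \<in> carrier M
      \<Longrightarrow> f (b \<otimes>\<^bsub>B\<^esub> h a) m = f b (a \<odot>\<^bsub>M\<^esub> m)"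
  obtains g where "g \<in> hom (add_monoid T) G"
    "\<And>b m. b \<in> carrier B \<Longrightarrow> m \<in> carrier M \<Longrightarrow> g (pt b m) = f b m"
proof -
  interpret G: comm_group G by (rule G)
  have "(\<lambda>(b, m). f b m) ` (carrier B \<times> carrier M) \<subseteq> carrier G" using closed by auto
  from G.free_Abelian_group_universal[OF this] obtain k where k: "k \<in> hom F G"
      "\<And>x. x \<in> carrier B \<times> carrier M \<Longrightarrow> k (frag_of x) = (\<lambda>(b, m). f b m) x"
    unfolding tensor_free_def by blast
  interpret k: group_hom F G k
    using k(1) group_F by (simp add: group_hom_def group_hom_axioms_def)
  have k_diff: "k (x - y) \<otimes>\<^bsub>G\<^esub> k y = k x" if "x \<in> carrier F" "y \<in> carrier F" for x y
    using k.hom_mult[of "x - y" y] that by (simp add: keys_diff_subset)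
  have kF: "k x \<in> carrier G" if "x \<in> carrier F" for x using that by (rule k.hom_closed)
  have cancel: "k (x - y) = \<one>\<^bsub>G\<^esub>" if "x \<in> carrier F" "y \<in> carrier F" "k x = k y" for x y
  proof -
    have "k (x - y) \<in> carrier G" using that by (intro kF) (auto simp: keys_diff_subset)
    then show ?thesis using k_diff[OF that(1,2)] that kF[OF that(2)] by (simp add: G.r_cancel_one)
  qed
  have rel: "k x = \<one>\<^bsub>G\<^esub>" if x: "x \<in> tensor_relations A B h M" for x
  proof -
    consider (1) b c m where "x = frag_of (b \<oplus>\<^bsub>B\<^esub> c, m) - frag_of (b, m) - frag_of (c, m)"
        "b \<in> carrier B" "c \<in> carrier B" "m \<in> carrier M"
      | (2) b m n where "x = frag_of (b, m \<oplus>\<^bsub>M\<^esub> n) - frag_of (b, m) - frag_of (b, n)"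
        "b \<in> carrier B" "m \<in> carrier M" "n \<in> carrier M"
      | (3) a b m where "x = frag_of (b \<otimes>\<^bsub>B\<^esub> h a, m) - frag_of (b, a \<odot>\<^bsub>M\<^esub> m)"
        "a \<in> carrier A" "b \<in> carrier B" "m \<in> carrier M"
      using x unfolding tensor_relations_def by blast
    then show ?thesis
    proof cases
      case 1
      have "k (frag_of (b, m) + frag_of (c, m)) = k (frag_of (b \<oplus>\<^bsub>B\<^esub> c, m))"
        using k.hom_mult[of "frag_of (b, m)" "frag_of (c, m)"] 1 k(2) by (simp add: add_left)
      then show ?thesis using 1
        by (simp add: diff_diff_eq) (intro cancel, simp_all add: keys_add_subset)
    next
      case 2
      have "k (frag_of (b, m) + frag_of (b, n)) = k (frag_of (b, m \<oplus>\<^bsub>M\<^esub> n))"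
        using k.hom_mult[of "frag_of (b, m)" "frag_of (b, n)"] 2 k(2) by (simp add: add_right)
      then show ?thesis using 2
        by (simp add: diff_diff_eq) (intro cancel, simp_all add: keys_add_subset)
    next
      case 3
      then have "k (frag_of (b \<otimes>\<^bsub>B\<^esub> h a, m)) = k (frag_of (b, a \<odot>\<^bsub>M\<^esub> m))"
        using k(2) h_closed balanced by simp
      then show ?thesis using 3 h_closed by (simp add: cancel)
    qed
  qed
  \<comment> \<open>The kernel is a subgroup, so it is enough that \<open>k\<close> kills the
    generating relations; \<open>k\<close> then factors through the quotient by
    \<open>N\<close>.\<close>
  have "N \<subseteq> Coset.kernel F G k"
    unfolding tensor_null_def
    by (rule group.generate_subgroup_incl[OF group_F _ k.subgroup_kernel])
      (use rel relations_closed in \<open>auto simp: Coset.kernel_def simp del: F_simps(3)\<close>)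
  then obtain g where g: "g \<in> hom (F Mod N) G" "\<And>x. x \<in> carrier F \<Longrightarrow> g (N #>\<^bsub>F\<^esub> x) = k x"
    using group_hom.FactGroup_universal_kernel[OF k.group_hom_axioms normal_N] by blast
  show ?thesis
  proof
    show "g \<in> hom (add_monoid T) G"
      using g(1) by (simp add: hom_def extend_scalars_def Let_def)
    show "g (pt b m) = f b m" if "b \<in> carrier B" "m \<in> carrier M" for b m
      using g(2)[of "frag_of (b, m)"] k(2) that by (simp add: pure_tensor_def tensor_class_def)
  qed
qed

end

subsection \<open>Transitivity\<close>

locale scalar_extension_tower =
  S\<^sub>1: scalar_extension A\<^sub>1 A\<^sub>2 h\<^sub>1 M +
  S\<^sub>2: scalar_extension A\<^sub>2 B h\<^sub>2 "extend_scalars A\<^sub>1 A\<^sub>2 h\<^sub>1 M" +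
  S: scalar_extension A\<^sub>1 B h M
  for A\<^sub>1 :: "('a\<^sub>1, 's\<^sub>1) ring_scheme" and A\<^sub>2 :: "('a\<^sub>2, 's\<^sub>2) ring_scheme" and B :: "('b, 't) ring_scheme"
    and h\<^sub>1 :: "'a\<^sub>1 \<Rightarrow> 'a\<^sub>2" and h\<^sub>2 :: "'a\<^sub>2 \<Rightarrow> 'b" and h :: "'a\<^sub>1 \<Rightarrow> 'b"
    and M :: "('a\<^sub>1, 'm, 'c) module_scheme" +
  assumes h\<^sub>2_hom: "h\<^sub>2 \<in> ring_hom A\<^sub>2 B"
    and h\<^sub>2_h\<^sub>1: "a \<in> carrier A\<^sub>1 \<Longrightarrow> h\<^sub>2 (h\<^sub>1 a) = h a"
begin

text \<open>In the application this is \<alpha> \<otimes> m^, with m^ = 1 \<otimes> m in the Fourier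
  transform.\<close>

abbreviation "gen \<alpha> m \<equiv> S\<^sub>2.pt \<alpha> (S\<^sub>1.pt \<one>\<^bsub>A\<^sub>2\<^esub> m)"

lemma gen_closed: "\<alpha> \<in> carrier B \<Longrightarrow> m \<in> carrier M \<Longrightarrow> gen \<alpha> m \<in> carrier S\<^sub>2.T"
  by (simp add: S\<^sub>2.pt_closed S\<^sub>1.pt_closed)

text \<open>Since a \<otimes> m = a (1 \<otimes> m), the outer balancing relation moves a across the
  outer tensor sign. This is why the elements \<open>gen\<close> generate everything.\<close>

lemma pt_pt_eq_gen:
  assumes "\<alpha> \<in> carrier B" "a \<in> carrier A\<^sub>2" "m \<in> carrier M"
  shows "S\<^sub>2.pt \<alpha> (S\<^sub>1.pt a m) = gen (\<alpha> \<otimes>\<^bsub>B\<^esub> h\<^sub>2 a) m"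
  using assms S\<^sub>1.smult_pt[of a "\<one>\<^bsub>A\<^sub>2\<^esub>" m] S\<^sub>2.pt_balanced[of a \<alpha> "S\<^sub>1.pt \<one>\<^bsub>A\<^sub>2\<^esub> m"]
  by (simp add: S\<^sub>1.pt_closed)

text \<open>For fixed \<alpha> the map y |-> g(\<alpha> \<otimes> y) is additive on the inner tensor
  product, so uniqueness on pure tensors is applied twice, outside and inside.\<close>

lemma hom_eq_on_gen:
  assumes G: "group G" and g: "g \<in> hom (add_monoid S\<^sub>2.T) G" and g': "g' \<in> hom (add_monoid S\<^sub>2.T) G"
    and eq: "\<And>\<alpha> m. \<alpha> \<in> carrier B \<Longrightarrow> m \<in> carrier M \<Longrightarrow> g (gen \<alpha> m) = g' (gen \<alpha> m)"
    and x: "x \<in> carrier S\<^sub>2.T"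
  shows "g x = g' x"
proof (rule S\<^sub>2.hom_eq_on_pt[OF G g g' _ x])
  fix \<alpha> y assume \<alpha>: "\<alpha> \<in> carrier B" and y: "y \<in> carrier S\<^sub>1.T"
  have hom: "(\<lambda>y. k (S\<^sub>2.pt \<alpha> y)) \<in> hom (add_monoid S\<^sub>1.T) G" if "k \<in> hom (add_monoid S\<^sub>2.T) G" for k
    using hom_in_carrier[OF that] hom_mult[OF that] \<alpha>
    by (intro homI) (simp_all add: S\<^sub>2.pt_closed S\<^sub>2.pt_add_right)
  show "g (S\<^sub>2.pt \<alpha> y) = g' (S\<^sub>2.pt \<alpha> y)"
    by (rule S\<^sub>1.hom_eq_on_pt[OF G hom[OF g] hom[OF g'] _ y])
      (simp only: pt_pt_eq_gen[OF \<alpha>] eq S\<^sub>2.B.m_closed[OF \<alpha>] S\<^sub>2.h_closed)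
qed

text \<open>The map is forced to send \<alpha> \<otimes> (a \<otimes> m) to \<alpha> h2(a) \<otimes>
  m. For each fixed \<alpha> the inner universal property gives a map \<open>g \<alpha>\<close>; the
  outer one then glues the family, once it is additive and balanced in \<alpha>.\<close>

lemma exists_hom_to_extension:
  obtains \<Upsilon> where "\<Upsilon> \<in> hom (add_monoid S\<^sub>2.T) (add_monoid S.T)"
    "\<And>\<alpha> m. \<alpha> \<in> carrier B \<Longrightarrow> m \<in> carrier M \<Longrightarrow> \<Upsilon> (gen \<alpha> m) = S.pt \<alpha> m"
proof -
  interpret T: abelian_group S.T by (rule S.abelian_group_T)
  have "\<exists>g. g \<in> hom (add_monoid S\<^sub>1.T) (add_monoid S.T) \<and>
      (\<forall>a\<in>carrier A\<^sub>2. \<forall>m\<in>carrier M. g (S\<^sub>1.pt a m) = S.pt (\<alpha> \<otimes>\<^bsub>B\<^esub> h\<^sub>2 a) m)"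
    if \<alpha>: "\<alpha> \<in> carrier B" for \<alpha>
  proof (rule S\<^sub>1.universal_property[OF T.a_comm_group, where f = "\<lambda>a m. S.pt (\<alpha> \<otimes>\<^bsub>B\<^esub> h\<^sub>2 a) m"])
    show "S.pt (\<alpha> \<otimes>\<^bsub>B\<^esub> h\<^sub>2 (b \<otimes>\<^bsub>A\<^sub>2\<^esub> h\<^sub>1 a)) m = S.pt (\<alpha> \<otimes>\<^bsub>B\<^esub> h\<^sub>2 b) (a \<odot>\<^bsub>M\<^esub> m)"
      if "a \<in> carrier A\<^sub>1" "b \<in> carrier A\<^sub>2" "m \<in> carrier M" for a b m
    proof -
      \<comment> \<open>Inner balancing is the place where the compatibility of the three scalar
        maps enters.\<close>
      have "h\<^sub>2 (b \<otimes>\<^bsub>A\<^sub>2\<^esub> h\<^sub>1 a) = h\<^sub>2 b \<otimes>\<^bsub>B\<^esub> h a"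
        using that by (simp add: ring_hom_mult[OF h\<^sub>2_hom] S\<^sub>1.h_closed h\<^sub>2_h\<^sub>1)
      then show ?thesis
        using that \<alpha> S.pt_balanced[of a "\<alpha> \<otimes>\<^bsub>B\<^esub> h\<^sub>2 b" m]
        by (simp add: S\<^sub>2.B.m_assoc S\<^sub>2.h_closed S.h_closed)
    qed
  qed (use \<alpha> in \<open>auto simp: S.pt_closed S\<^sub>2.h_closed ring_hom_add[OF h\<^sub>2_hom] S\<^sub>2.B.r_distr
        S.pt_add_left S.pt_add_right\<close>)
  then obtain g where g: "\<And>\<alpha>. \<alpha> \<in> carrier B \<Longrightarrow> g \<alpha> \<in> hom (add_monoid S\<^sub>1.T) (add_monoid S.T)"
    and g_pt: "\<And>\<alpha> a m. \<alpha> \<in> carrier B \<Longrightarrow> a \<in> carrier A\<^sub>2 \<Longrightarrow> m \<in> carrier M \<Longrightarrow>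
      g \<alpha> (S\<^sub>1.pt a m) = S.pt (\<alpha> \<otimes>\<^bsub>B\<^esub> h\<^sub>2 a) m"
    by metis
  have g_closed: "g \<alpha> x \<in> carrier S.T" if "\<alpha> \<in> carrier B" "x \<in> carrier S\<^sub>1.T" for \<alpha> x
    using hom_in_carrier[OF g] that by simp
  have g_add: "g \<alpha> (x \<oplus>\<^bsub>S\<^sub>1.T\<^esub> y) = g \<alpha> x \<oplus>\<^bsub>S.T\<^esub> g \<alpha> y"
    if "\<alpha> \<in> carrier B" "x \<in> carrier S\<^sub>1.T" "y \<in> carrier S\<^sub>1.T" for \<alpha> x y
    using hom_mult[OF g] that by simp
  obtain \<Upsilon> where \<Upsilon>: "\<Upsilon> \<in> hom (add_monoid S\<^sub>2.T) (add_monoid S.T)"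
    "\<And>\<alpha> x. \<alpha> \<in> carrier B \<Longrightarrow> x \<in> carrier S\<^sub>1.T \<Longrightarrow> \<Upsilon> (S\<^sub>2.pt \<alpha> x) = g \<alpha> x"
  proof (rule S\<^sub>2.universal_property[OF T.a_comm_group, where f = g])
    \<comment> \<open>The values of \<open>g\<close> are known only on inner pure tensors. For
      arbitrary x both sides are viewed as additive maps in x and compared there; balancing below is
      treated in the same way.\<close>
    show "g (\<alpha> \<oplus>\<^bsub>B\<^esub> \<beta>) x = g \<alpha> x \<otimes>\<^bsub>add_monoid S.T\<^esub> g \<beta> x"
      if \<alpha>: "\<alpha> \<in> carrier B" and \<beta>: "\<beta> \<in> carrier B" and x: "x \<in> carrier S\<^sub>1.T" for \<alpha> \<beta> x
    proof (rule S\<^sub>1.hom_eq_on_pt[OF T.a_group g _ _ x])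
      show "(\<lambda>x. g \<alpha> x \<otimes>\<^bsub>add_monoid S.T\<^esub> g \<beta> x) \<in> hom (add_monoid S\<^sub>1.T) (add_monoid S.T)"
        by (rule homI) (use \<alpha> \<beta> in \<open>simp_all add: g_closed g_add T.a_ac\<close>)
    qed (use \<alpha> \<beta> in \<open>simp_all add: g_pt S\<^sub>2.h_closed S\<^sub>2.B.l_distr S.pt_add_left\<close>)
    show "g (\<alpha> \<otimes>\<^bsub>B\<^esub> h\<^sub>2 a) x = g \<alpha> (a \<odot>\<^bsub>S\<^sub>1.T\<^esub> x)"
      if a: "a \<in> carrier A\<^sub>2" and \<alpha>: "\<alpha> \<in> carrier B" and x: "x \<in> carrier S\<^sub>1.T" for a \<alpha> x
    proof (rule S\<^sub>1.hom_eq_on_pt[OF T.a_group g _ _ x])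
      show "(\<lambda>x. g \<alpha> (a \<odot>\<^bsub>S\<^sub>1.T\<^esub> x)) \<in> hom (add_monoid S\<^sub>1.T) (add_monoid S.T)"
        by (rule homI) (use \<alpha> a in \<open>simp_all add: g_closed g_add S\<^sub>2.M.smult_r_distr\<close>)
    qed (use \<alpha> a in \<open>simp_all add: g_pt S\<^sub>2.h_closed S\<^sub>1.smult_pt S\<^sub>2.B.m_assoc ring_hom_mult[OF h\<^sub>2_hom]\<close>)
  qed (simp_all add: g_closed g_add)
  show thesis
    by (rule that[OF \<Upsilon>(1)])
      (simp add: \<Upsilon>(2) S\<^sub>1.pt_closed g_pt ring_hom_one[OF h\<^sub>2_hom])
qed

lemma exists_hom_from_extension:
  obtains k where "k \<in> hom (add_monoid S.T) (add_monoid S\<^sub>2.T)"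
    "\<And>\<alpha> m. \<alpha> \<in> carrier B \<Longrightarrow> m \<in> carrier M \<Longrightarrow> k (S.pt \<alpha> m) = gen \<alpha> m"
proof -
  interpret T: abelian_group S\<^sub>2.T by (rule S\<^sub>2.abelian_group_T)
  \<comment> \<open>With h(a) = h2(h1(a)), the scalar first crosses the outer tensor sign, becoming
    h1(a) \<otimes> m, and then the inner one, becoming 1 \<otimes> a m.\<close>
  have balanced: "gen (\<alpha> \<otimes>\<^bsub>B\<^esub> h a) m = gen \<alpha> (a \<odot>\<^bsub>M\<^esub> m)"
    if "a \<in> carrier A\<^sub>1" "\<alpha> \<in> carrier B" "m \<in> carrier M" for a \<alpha> m
    using that pt_pt_eq_gen[of \<alpha> "h\<^sub>1 a" m] S\<^sub>1.pt_balanced[of a "\<one>\<^bsub>A\<^sub>2\<^esub>" m]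
    by (simp add: h\<^sub>2_h\<^sub>1 S\<^sub>1.h_closed)
  show thesis
    by (rule S.universal_property[OF T.a_comm_group, where f = gen])
      (auto simp: gen_closed S\<^sub>2.pt_add_left S\<^sub>2.pt_add_right S\<^sub>1.pt_add_right S\<^sub>1.pt_closed balanced
        intro: that)
qed

text \<open>Both composites with the map in the other direction fix generators, hence are
  identities; linearity is likewise an identity of additive maps on generators. The map is arbitrary
  subject to its values on generators, to match the quantification over all maps satisfying
  \<open>is_Upsilon\<close>.\<close>

lemma hom_to_extension_iso:
  assumes \<Upsilon>: "\<Upsilon> \<in> hom (add_monoid S\<^sub>2.T) (add_monoid S.T)"
    and gen: "\<And>\<alpha> m. \<alpha> \<in> carrier B \<Longrightarrow> m \<in> carrier M \<Longrightarrow> \<Upsilon> (gen \<alpha> m) = S.pt \<alpha> m"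
  shows "left_module_iso B S\<^sub>2.T S.T \<Upsilon>"
proof -
  interpret T\<^sub>2: left_module B S\<^sub>2.T by (rule S\<^sub>2.left_module_T)
  interpret T: left_module B S.T by (rule S.left_module_T)
  obtain k where k: "k \<in> hom (add_monoid S.T) (add_monoid S\<^sub>2.T)"
    "\<And>\<alpha> m. \<alpha> \<in> carrier B \<Longrightarrow> m \<in> carrier M \<Longrightarrow> k (S.pt \<alpha> m) = gen \<alpha> m"
    by (rule exists_hom_from_extension) blast
  have \<Upsilon>_closed: "\<Upsilon> x \<in> carrier S.T" if "x \<in> carrier S\<^sub>2.T" for x
    using hom_in_carrier[OF \<Upsilon>] that by simp
  have \<Upsilon>_add: "\<Upsilon> (x \<oplus>\<^bsub>S\<^sub>2.T\<^esub> y) = \<Upsilon> x \<oplus>\<^bsub>S.T\<^esub> \<Upsilon> y"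
    if "x \<in> carrier S\<^sub>2.T" "y \<in> carrier S\<^sub>2.T" for x y
    using hom_mult[OF \<Upsilon>] that by simp
  have id_hom: "(\<lambda>x. x) \<in> hom G G" for G :: "('x, 'y) monoid_scheme" by (simp add: hom_def)
  have k\<Upsilon>: "k (\<Upsilon> x) = x" if "x \<in> carrier S\<^sub>2.T" for x
    using hom_eq_on_gen[OF T\<^sub>2.a_group hom_compose[OF \<Upsilon> k(1)] id_hom _ that] gen k(2) by simp
  have \<Upsilon>k: "\<Upsilon> (k x) = x" if "x \<in> carrier S.T" for x
    using S.hom_eq_on_pt[OF T.a_group hom_compose[OF k(1) \<Upsilon>] id_hom _ that] gen k(2) by simp
  have "bij_betw \<Upsilon> (carrier S\<^sub>2.T) (carrier S.T)"
    by (rule bij_betw_byWitness[where f' = k])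
      (use k\<Upsilon> \<Upsilon>k \<Upsilon>_closed hom_in_carrier[OF k(1)] in auto)
  then have "\<Upsilon> \<in> iso (add_monoid S\<^sub>2.T) (add_monoid S.T)"
    using \<Upsilon> by (simp add: iso_def)
  moreover have "\<Upsilon> (r \<odot>\<^bsub>S\<^sub>2.T\<^esub> x) = r \<odot>\<^bsub>S.T\<^esub> \<Upsilon> x" if r: "r \<in> carrier B" and x: "x \<in> carrier S\<^sub>2.T" for r x
  proof (rule hom_eq_on_gen[OF T.a_group _ _ _ x])
    show "(\<lambda>x. \<Upsilon> (r \<odot>\<^bsub>S\<^sub>2.T\<^esub> x)) \<in> hom (add_monoid S\<^sub>2.T) (add_monoid S.T)"
      by (rule homI) (use r in \<open>simp_all add: \<Upsilon>_closed \<Upsilon>_add T\<^sub>2.smult_r_distr\<close>)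
    show "(\<lambda>x. r \<odot>\<^bsub>S.T\<^esub> \<Upsilon> x) \<in> hom (add_monoid S\<^sub>2.T) (add_monoid S.T)"
      by (rule homI) (use r in \<open>simp_all add: \<Upsilon>_closed \<Upsilon>_add T.smult_r_distr\<close>)
  qed (use r in \<open>simp add: S\<^sub>2.smult_pt S.smult_pt gen\<close>)
  ultimately show ?thesis
    using S\<^sub>2.left_module_T S.left_module_T by (simp add: left_module_iso_def)
qed

end

section \<open>Restriction of scalars along a ring homomorphism\<close>

lemma restrict_scalars_simps [simp]:
  "carrier (restrict_scalars h M) = carrier M"
  "\<zero>\<^bsub>restrict_scalars h M\<^esub> = \<zero>\<^bsub>M\<^esub>"
  "x \<oplus>\<^bsub>restrict_scalars h M\<^esub> y = x \<oplus>\<^bsub>M\<^esub> y"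
  "r \<odot>\<^bsub>restrict_scalars h M\<^esub> x = h r \<odot>\<^bsub>M\<^esub> x"
  by (simp_all add: restrict_scalars_def)

lemma left_module_restrict_scalars:
  assumes "ring R" "h \<in> ring_hom R S" "left_module S M"
  shows "left_module R (restrict_scalars h M)"
proof -
  interpret M: left_module S M by fact
  have "abelian_group (restrict_scalars h M)"
    by (rule abelian_groupI) (auto simp: M.a_ac intro: M.l_neg bexI[where x = "\<ominus>\<^bsub>M\<^esub> _"])
  then show ?thesis
    using assms(1)
    by (intro left_module.intro left_module_axioms.intro)
      (auto simp: ring_hom_closed[OF assms(2)] ring_hom_add[OF assms(2)] ring_hom_mult[OF assms(2)]
        ring_hom_one[OF assms(2)] M.smult_l_distr M.smult_r_distr M.smult_assoc)
qed

lemma left_module_iso_restrict_scalars: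
  assumes "ring R" "h \<in> ring_hom R S" "left_module_iso S M N f"
  shows "left_module_iso R (restrict_scalars h M) (restrict_scalars h N) f"
  using assms(3) ring_hom_closed[OF assms(2)]
  unfolding left_module_iso_def iso_def hom_def
  by (auto intro!: left_module_restrict_scalars[OF assms(1,2)])

section \<open>The product of formal sums\<close>

abbreviation fps_deriv_iter :: "nat \<Rightarrow> complex fps \<Rightarrow> complex fps" ("\<partial>\<^bsup>_\<^esup>") where
  "\<partial>\<^bsup>n\<^esup> \<equiv> fps_deriv ^^ n"

lemma fps_deriv_iter_add: "\<partial>\<^bsup>n\<^esup> (f + g) = \<partial>\<^bsup>n\<^esup> f + \<partial>\<^bsup>n\<^esup> g"
  by (induction n) simp_all

lemma fps_deriv_iter_0 [simp]: "\<partial>\<^bsup>n\<^esup> 0 = 0"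
  by (induction n) simp_all

lemma fps_deriv_iter_sum: "\<partial>\<^bsup>n\<^esup> (sum f A) = (\<Sum>x\<in>A. \<partial>\<^bsup>n\<^esup> (f x))"
  by (induction A rule: infinite_finite_induct) (simp_all add: fps_deriv_iter_add)

lemma fps_deriv_iter_const_mult: "\<partial>\<^bsup>n\<^esup> (fps_const c * f) = fps_const c * \<partial>\<^bsup>n\<^esup> f"
  by (induction n) simp_all

lemma fps_deriv_iter_mult:
  "\<partial>\<^bsup>n\<^esup> (f * g) = (\<Sum>k\<le>n. fps_const (of_nat (n choose k)) * (\<partial>\<^bsup>n - k\<^esup> f * \<partial>\<^bsup>k\<^esup> g))"
proof (induction n)
  case (Suc n)
  let ?t = "\<lambda>i j. \<partial>\<^bsup>i\<^esup> f * \<partial>\<^bsup>j\<^esup> g"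
  let ?c = "\<lambda>n k. fps_const (of_nat (n choose k)) :: complex fps"
  have "\<partial>\<^bsup>Suc n\<^esup> (f * g) = (\<Sum>k\<le>n. ?c n k * (?t (Suc (n - k)) k + ?t (n - k) (Suc k)))"
    by (simp add: Suc fps_deriv_sum algebra_simps)
  also have "\<dots> = (\<Sum>k\<le>n. ?c n k * ?t (Suc n - k) k) + (\<Sum>k\<le>n. ?c n k * ?t (n - k) (Suc k))"
    by (simp only: distrib_left sum.distrib) (simp add: Suc_diff_le)
  also have "(\<Sum>k\<le>n. ?c n k * ?t (Suc n - k) k)
      = ?t (Suc n) 0 + (\<Sum>k\<le>n. ?c n (Suc k) * ?t (n - k) (Suc k))"
    using sum.atMost_Suc_shift[of "\<lambda>k. ?c n k * ?t (Suc n - k) k" n] by (simp add: binomial_eq_0)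
  also have "?t (Suc n) 0 + (\<Sum>k\<le>n. ?c n (Suc k) * ?t (n - k) (Suc k)) + (\<Sum>k\<le>n. ?c n k * ?t (n - k) (Suc k))
      = ?t (Suc n) 0 + (\<Sum>k\<le>n. ?c (Suc n) (Suc k) * ?t (n - k) (Suc k))"
    by (simp add: algebra_simps flip: sum.distrib fps_const_add)
  also have "\<dots> = (\<Sum>k\<le>Suc n. ?c (Suc n) k * ?t (Suc n - k) k)"
    by (subst sum.atMost_Suc_shift) simp
  finally show ?case .
qed simp

lemma fps_const_sum: "fps_const (sum f A) = (\<Sum>x\<in>A. fps_const (f x))"
  by (induction A rule: infinite_finite_induct) (simp_all flip: fps_const_add)

text \<open>Trinomial revision extracts the factor (x choose a) from every summand; what remains is
  Vandermonde's convolution for (x - a) + y. Associativity of the product comes down to this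
  identity.\<close>

lemma gbinomial_mult_shift_eq_sum:
  fixes x y :: complex
  shows "(x gchoose a) * ((x + y - of_nat a) gchoose b)
    = (\<Sum>e\<le>b. (x gchoose (a + e)) * (y gchoose (b - e)) * of_nat ((a + e) choose e))"
proof -
  have "(x gchoose (a + e)) * of_nat ((a + e) choose e) = (x gchoose a) * ((x - of_nat a) gchoose e)" for e
    using gbinomial_trinomial_revision[of a "a + e" x] binomial_symmetric[of e "a + e"]
    by (simp add: binomial_gbinomial)
  then have "(\<Sum>e\<le>b. (x gchoose (a + e)) * (y gchoose (b - e)) * of_nat ((a + e) choose e))
      = (\<Sum>e\<le>b. (x gchoose a) * (((x - of_nat a) gchoose e) * (y gchoose (b - e))))"
    by (intro sum.cong) (simp_all add: mult_ac)
  also have "\<dots> = (x gchoose a) * ((x - of_nat a + y) gchoose b)"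
    by (simp add: gbinomial_Vandermonde atMost_atLeast0 flip: sum_distrib_left)
  finally show ?thesis by (simp add: algebra_simps)
qed

text \<open>A single symmetric index set instead of nested sums with truncated subtraction, so that
  the rearrangements in the proof of associativity are bijections checked by arithmetic.\<close>

definition triples :: "nat \<Rightarrow> (nat \<times> nat \<times> nat) set" where
  "triples l = {(\<alpha>, i, j). \<alpha> + i + j = l}"

lemma triples_subset: "triples l \<subseteq> (\<lambda>(\<alpha>, i). (\<alpha>, i, l - \<alpha> - i)) ` ({..l} \<times> {..l})"
  unfolding triples_def by (auto simp: image_iff)

lemma finite_triples [simp, intro]: "finite (triples l)"
  by (rule finite_subset[OF triples_subset]) simp

text \<open>If \<open>P = \<Sum>\<^sub>k p\<^sub>k t\<^bsup>r-k\<^esup>\<close> and \<open>Q = \<Sum>\<^sub>k q\<^sub>k t\<^bsup>s-k\<^esup>\<close>, then \<open>star r p q l\<close> is the coefficient of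
  \<open>t\<^bsup>r+s-l\<^esup>\<close> in \<open>P \<cdot> Q\<close>.\<close>

definition star :: "int \<Rightarrow> (nat \<Rightarrow> complex fps) \<Rightarrow> (nat \<Rightarrow> complex fps) \<Rightarrow> nat \<Rightarrow> complex fps" where
  "star r p q l = (\<Sum>(\<alpha>, i, j)\<in>triples l. fps_const (of_int (r - int i) gchoose \<alpha>) * (p i * \<partial>\<^bsup>\<alpha>\<^esup> (q j)))"

lemma star_add_left: "star r (\<lambda>i. p i + p' i) q l = star r p q l + star r p' q l"
  by (simp add: star_def algebra_simps case_prod_unfold flip: sum.distrib)

lemma star_add_right: "star r p (\<lambda>i. q i + q' i) l = star r p q l + star r p q' l"
  by (simp add: star_def algebra_simps case_prod_unfold fps_deriv_iter_add flip: sum.distrib)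

text \<open>Both sides are combinations of the products of p_a, the \<alpha>-th derivative of q_b
  and the \<beta>-th derivative of w_c. On the left \<alpha> and \<beta> are the two summation
  indices; on the right they arise when \<gamma> derivatives of a product are distributed,
  \<epsilon> of them falling on w_c. The coefficients agree by the preceding binomial
  identity.\<close>

lemma star_assoc: "star (r + s) (star r p q) w l = star r p (star s q w) l"
proof -
  let ?X = "\<lambda>a b c \<alpha> \<beta>. p a * (\<partial>\<^bsup>\<alpha>\<^esup> (q b) * \<partial>\<^bsup>\<beta>\<^esup> (w c))"
  let ?g = "\<lambda>r i \<alpha>. (of_int (r - int i) :: complex) gchoose \<alpha>"
  define Q where "Q = {(a, b, c, n). a + b + c + n = l}"
  have "Q \<subseteq> {..l} \<times> {..l} \<times> {..l} \<times> {..l}" by (auto simp: Q_def)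
  then have finQ: "finite Q" by (rule finite_subset) simp
  have "star (r + s) (star r p q) w l
    = (\<Sum>(\<beta>, m, c)\<in>triples l. \<Sum>(\<alpha>, a, b)\<in>triples m. fps_const (?g (r + s) m \<beta> * ?g r a \<alpha>) * ?X a b c \<alpha> \<beta>)"
    unfolding star_def
    by (intro sum.cong refl) (auto simp: sum_distrib_left sum_distrib_right mult_ac fps_const_mult[symmetric]
        simp del: fps_const_mult intro!: sum.cong)
  also have "\<dots> = (\<Sum>((\<beta>, m, c), (\<alpha>, a, b))\<in>Sigma (triples l) (\<lambda>(\<beta>, m, c). triples m).
      fps_const (?g (r + s) m \<beta> * ?g r a \<alpha>) * ?X a b c \<alpha> \<beta>)"
    by (subst sum.Sigma[symmetric]) (auto intro!: sum.cong)
  \<comment> \<open>Here n = \<alpha> + \<beta> is the total number of derivatives, and the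
    intermediate index m = \<alpha> + a + b is determined by the others.\<close>
  also have "\<dots> = (\<Sum>((a, b, c, n), \<alpha>)\<in>Sigma Q (\<lambda>(a, b, c, n). {..n}).
      fps_const (?g (r + s) (\<alpha> + a + b) (n - \<alpha>) * ?g r a \<alpha>) * ?X a b c \<alpha> (n - \<alpha>))"
    by (rule sum.reindex_bij_witness[where
          i = "\<lambda>((a, b, c, n), \<alpha>). ((n - \<alpha>, \<alpha> + a + b, c), (\<alpha>, a, b))" and
          j = "\<lambda>((\<beta>, m, c), (\<alpha>, a, b)). ((a, b, c, \<alpha> + \<beta>), \<alpha>)"])
      (auto simp: Q_def triples_def)
  \<comment> \<open>The binomial identity is used with x = r - a and y = s - b; since m = \<alpha> +
    a + b, the upper entry r + s - m is x + y - \<alpha>. It creates the Leibniz index \<epsilon> of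
    the other bracketing.\<close>
  also have "\<dots> = (\<Sum>((a, b, c, n), \<alpha>)\<in>Sigma Q (\<lambda>(a, b, c, n). {..n}). \<Sum>\<epsilon>\<le>n - \<alpha>.
      fps_const (?g r a (\<alpha> + \<epsilon>) * ?g s b (n - \<alpha> - \<epsilon>) * of_nat ((\<alpha> + \<epsilon>) choose \<epsilon>)) * ?X a b c \<alpha> (n - \<alpha>))"
  proof (intro sum.cong refl, clarify)
    fix a b c n \<alpha>
    have "?g (r + s) (\<alpha> + a + b) (n - \<alpha>) * ?g r a \<alpha>
        = (\<Sum>\<epsilon>\<le>n - \<alpha>. ?g r a (\<alpha> + \<epsilon>) * ?g s b (n - \<alpha> - \<epsilon>) * of_nat ((\<alpha> + \<epsilon>) choose \<epsilon>))"
      using gbinomial_mult_shift_eq_sum[of "of_int (r - int a)" \<alpha> "of_int (s - int b)" "n - \<alpha>"]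
      by (simp add: algebra_simps)
    then show "fps_const (?g (r + s) (\<alpha> + a + b) (n - \<alpha>) * ?g r a \<alpha>) * ?X a b c \<alpha> (n - \<alpha>)
        = (\<Sum>\<epsilon>\<le>n - \<alpha>. fps_const (?g r a (\<alpha> + \<epsilon>) * ?g s b (n - \<alpha> - \<epsilon>) * of_nat ((\<alpha> + \<epsilon>) choose \<epsilon>)) * ?X a b c \<alpha> (n - \<alpha>))"
      by (simp only: sum_distrib_right[symmetric] fps_const_sum)
  qed
  also have "\<dots> = (\<Sum>(((a, b, c, n), \<alpha>), \<epsilon>)\<in>Sigma (Sigma Q (\<lambda>(a, b, c, n). {..n})) (\<lambda>((a, b, c, n), \<alpha>). {..n - \<alpha>}).
      fps_const (?g r a (\<alpha> + \<epsilon>) * ?g s b (n - \<alpha> - \<epsilon>) * of_nat ((\<alpha> + \<epsilon>) choose \<epsilon>)) * ?X a b c \<alpha> (n - \<alpha>))"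
    by (subst sum.Sigma[symmetric]) (auto intro!: sum.cong finite_SigmaI finQ)
  also have "\<dots> = (\<Sum>(((\<gamma>, a, m), (\<delta>, b, c)), \<epsilon>)\<in>Sigma (Sigma (triples l) (\<lambda>(\<gamma>, a, m). triples m)) (\<lambda>((\<gamma>, a, m), (\<delta>, b, c)). {..\<gamma>}).
      fps_const (?g r a \<gamma> * ?g s b \<delta> * of_nat (\<gamma> choose \<epsilon>)) * ?X a b c (\<gamma> - \<epsilon>) (\<delta> + \<epsilon>))"
    \<comment> \<open>\<open>\<gamma> = \<alpha> + \<epsilon>\<close> and \<open>\<delta> = \<beta> - \<epsilon>\<close> with \<open>\<beta> = n - \<alpha>\<close>\<close>
    by (rule sum.reindex_bij_witness[where
          j = "\<lambda>(((a, b, c, n), \<alpha>), \<epsilon>). (((\<alpha> + \<epsilon>, a, (n - \<alpha> - \<epsilon>) + b + c), (n - \<alpha> - \<epsilon>, b, c)), \<epsilon>)" and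
          i = "\<lambda>(((\<gamma>, a, m), (\<delta>, b, c)), \<epsilon>). (((a, b, c, \<gamma> + \<delta>), \<gamma> - \<epsilon>), \<epsilon>)"])
      (auto simp: Q_def triples_def)
  also have "\<dots> = (\<Sum>((\<gamma>, a, m), (\<delta>, b, c))\<in>Sigma (triples l) (\<lambda>(\<gamma>, a, m). triples m). \<Sum>\<epsilon>\<le>\<gamma>.
      fps_const (?g r a \<gamma> * ?g s b \<delta> * of_nat (\<gamma> choose \<epsilon>)) * ?X a b c (\<gamma> - \<epsilon>) (\<delta> + \<epsilon>))"
    by (subst sum.Sigma[symmetric]) (auto intro!: sum.cong finite_SigmaI)
  also have "\<dots> = (\<Sum>(\<gamma>, a, m)\<in>triples l. \<Sum>(\<delta>, b, c)\<in>triples m. \<Sum>\<epsilon>\<le>\<gamma>.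
      fps_const (?g r a \<gamma> * ?g s b \<delta> * of_nat (\<gamma> choose \<epsilon>)) * ?X a b c (\<gamma> - \<epsilon>) (\<delta> + \<epsilon>))"
    by (subst sum.Sigma[symmetric]) (auto intro!: sum.cong)
  also have "\<dots> = star r p (star s q w) l"
  proof -
    \<comment> \<open>The sum over \<epsilon> is recognised as the Leibniz expansion of the
      \<gamma>-th derivative of each term of the inner product.\<close>
    have "fps_const (?g r a \<gamma>) * (p a * \<partial>\<^bsup>\<gamma>\<^esup> (star s q w m)) = (\<Sum>(\<delta>, b, c)\<in>triples m. \<Sum>\<epsilon>\<le>\<gamma>.
      fps_const (?g r a \<gamma> * ?g s b \<delta> * of_nat (\<gamma> choose \<epsilon>)) * ?X a b c (\<gamma> - \<epsilon>) (\<delta> + \<epsilon>))" for \<gamma> a m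
    proof -
      have comp: "\<partial>\<^bsup>\<epsilon>\<^esup> (\<partial>\<^bsup>\<delta>\<^esup> f) = \<partial>\<^bsup>\<delta> + \<epsilon>\<^esup> f" for \<epsilon> \<delta> f
        by (simp add: funpow_add add.commute[of \<delta>])
      have D: "\<partial>\<^bsup>\<gamma>\<^esup> (case x of (\<delta>, b, c) \<Rightarrow> fps_const (?g s b \<delta>) * (q b * \<partial>\<^bsup>\<delta>\<^esup> (w c)))
          = (case x of (\<delta>, b, c) \<Rightarrow> \<Sum>\<epsilon>\<le>\<gamma>. fps_const (?g s b \<delta>) *
              (fps_const (of_nat (\<gamma> choose \<epsilon>)) * (\<partial>\<^bsup>\<gamma> - \<epsilon>\<^esup> (q b) * \<partial>\<^bsup>\<delta> + \<epsilon>\<^esup> (w c))))" for x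
        by (cases x) (simp only: prod.case fps_deriv_iter_const_mult, simp only: fps_deriv_iter_mult comp sum_distrib_left)
      show ?thesis
        unfolding star_def fps_deriv_iter_sum D sum_distrib_left
      proof (intro sum.cong refl, clarify)
        fix \<delta> b c
        show "fps_const (?g r a \<gamma>) * (p a * (\<Sum>\<epsilon>\<le>\<gamma>. fps_const (?g s b \<delta>) *
              (fps_const (of_nat (\<gamma> choose \<epsilon>)) * (\<partial>\<^bsup>\<gamma> - \<epsilon>\<^esup> (q b) * \<partial>\<^bsup>\<delta> + \<epsilon>\<^esup> (w c)))))
          = (\<Sum>\<epsilon>\<le>\<gamma>. fps_const (?g r a \<gamma> * ?g s b \<delta> * of_nat (\<gamma> choose \<epsilon>)) * ?X a b c (\<gamma> - \<epsilon>) (\<delta> + \<epsilon>))"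
          unfolding sum_distrib_left
          by (intro sum.cong refl) (simp add: mult_ac fps_const_mult[symmetric] del: fps_const_mult)
      qed
    qed
    then show ?thesis by (simp add: star_def[of r p])
  qed
  finally show ?thesis .
qed

section \<open>From the coefficient formula to the product of formal sums\<close>

abbreviation vanishes_above :: "int \<Rightarrow> fsum \<Rightarrow> bool" where
  "vanishes_above r P \<equiv> \<forall>i>r. P i = 0"

text \<open>The falling factorial (i + \<alpha>) ... (i + 1) is written as \<alpha>! times a
  generalised binomial coefficient, which is correct for negative exponents too; the \<alpha>! later
  cancels the factor 1/\<alpha>! of the product.\<close>

lemma d_t_iter:
  "(d_t ^^ \<alpha>) P i = fps_const (fact \<alpha> * (of_int (i + int \<alpha>) gchoose \<alpha>)) * P (i + int \<alpha>)"
proof (induction \<alpha> arbitrary: i)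
  case (Suc \<alpha>)
  have "fact (Suc \<alpha>) * ((of_int (i + int (Suc \<alpha>)) :: complex) gchoose Suc \<alpha>)
      = of_int (i + 1) * (fact \<alpha> * (of_int (i + 1 + int \<alpha>) gchoose \<alpha>))"
    unfolding mult.left_commute[of "of_int (i + 1)"] gbinomial_mult_fact by (simp add: algebra_simps)
  moreover have "(d_t ^^ Suc \<alpha>) P i = fps_const (of_int (i + 1)) * (d_t ^^ \<alpha>) P (i + 1)"
    by (simp only: funpow.simps o_apply d_t_def[of "(d_t ^^ \<alpha>) P"] fps_of_int)
  moreover have "i + int (Suc \<alpha>) = i + 1 + int \<alpha>" by simp
  ultimately show ?case by (simp only: Suc mult.assoc[symmetric] fps_const_mult)
qed simp

lemma d_eta_iter: "(d_eta ^^ \<alpha>) P i = \<partial>\<^bsup>\<alpha>\<^esup> (P i)"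
  by (induction \<alpha> arbitrary: i) (simp_all add: d_eta_def)

lemma micro_mult_eq_star:
  assumes P: "vanishes_above r P" and Q: "vanishes_above s Q"
  shows "micro_mult P Q (r + s - int l) = star r (\<lambda>k. P (r - int k)) (\<lambda>k. Q (s - int k)) l"
proof -
  let ?n = "r + s - int l"
  let ?f = "\<lambda>\<alpha> k. fps_const (of_int (r - int k) gchoose \<alpha>) * (P (r - int k) * \<partial>\<^bsup>\<alpha>\<^esup> (Q (s - int (l - \<alpha> - k))))"
  have 1: "fps_const (1 / fact \<alpha>) * comm_mult ((d_t ^^ \<alpha>) P) ((d_eta ^^ \<alpha>) Q) ?n = (\<Sum>k | \<alpha> + k \<le> l. ?f \<alpha> k)" for \<alpha>
  proof -
    let ?h = "\<lambda>i. (d_t ^^ \<alpha>) P i * (d_eta ^^ \<alpha>) Q (?n - i)"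
    \<comment> \<open>The bounds on the orders of \<open>P\<close> and \<open>Q\<close> confine i
      from above and below. Its distance k to the largest possible value r - \<alpha> becomes the
      new index, at which the coefficient of \<open>P\<close> involved is the one of t^(r -
      k).\<close>
    have "{i. ?h i \<noteq> 0} \<subseteq> (\<lambda>k. r - int \<alpha> - int k) ` {k. \<alpha> + k \<le> l}"
    proof
      fix i assume "i \<in> {i. ?h i \<noteq> 0}"
      then have "P (i + int \<alpha>) \<noteq> 0" "Q (?n - i) \<noteq> 0" by (auto simp: d_t_iter d_eta_iter)
      then have "i + int \<alpha> \<le> r" "?n - i \<le> s" using P Q by (meson not_less)+
      then show "i \<in> (\<lambda>k. r - int \<alpha> - int k) ` {k. \<alpha> + k \<le> l}"
        by (intro image_eqI[of _ _ "nat (r - int \<alpha> - i)"]) auto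
    qed
    moreover have fin: "finite {k. \<alpha> + k \<le> l}" by (rule finite_subset[of _ "{..l}"]) auto
    ultimately have "comm_mult ((d_t ^^ \<alpha>) P) ((d_eta ^^ \<alpha>) Q) ?n = sum ?h ((\<lambda>k. r - int \<alpha> - int k) ` {k. \<alpha> + k \<le> l})"
      unfolding comm_mult_def by (intro Sum_any.expand_superset) auto
    also have "\<dots> = (\<Sum>k | \<alpha> + k \<le> l. ?h (r - int \<alpha> - int k))"
      by (subst sum.reindex) (auto simp: inj_on_def)
    also have "\<dots> = (\<Sum>k | \<alpha> + k \<le> l. fps_const (fact \<alpha>) * ?f \<alpha> k)"
    proof (intro sum.cong refl)
      fix k assume "k \<in> {k. \<alpha> + k \<le> l}"
      then obtain j where l: "l = \<alpha> + k + j" using le_Suc_ex by blast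
      then have "?n - (r - int \<alpha> - int k) = s - int j" "l - \<alpha> - k = j" by simp_all
      then show "?h (r - int \<alpha> - int k) = fps_const (fact \<alpha>) * ?f \<alpha> k"
        by (simp only: d_t_iter d_eta_iter diff_add_eq diff_add_cancel) (simp add: mult_ac flip: fps_const_mult)
    qed
    also have "\<dots> = fps_const (fact \<alpha>) * (\<Sum>k | \<alpha> + k \<le> l. ?f \<alpha> k)"
      by (rule sum_distrib_left[symmetric])
    finally have e: "comm_mult ((d_t ^^ \<alpha>) P) ((d_eta ^^ \<alpha>) Q) ?n = \<dots>" .
    show ?thesis unfolding e mult.assoc[symmetric] by simp
  qed
  have "{\<alpha>. (\<Sum>k | \<alpha> + k \<le> l. ?f \<alpha> k) \<noteq> 0} \<subseteq> {..l}"
  proof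
    fix \<alpha> assume "\<alpha> \<in> {\<alpha>. (\<Sum>k | \<alpha> + k \<le> l. ?f \<alpha> k) \<noteq> 0}"
    then have "{k. \<alpha> + k \<le> l} \<noteq> {}" by (auto simp del: Collect_empty_eq)
    then show "\<alpha> \<in> {..l}" by auto
  qed
  then have "micro_mult P Q ?n = (\<Sum>\<alpha>\<le>l. \<Sum>k | \<alpha> + k \<le> l. ?f \<alpha> k)"
    unfolding micro_mult_def 1 by (intro Sum_any.expand_superset) auto
  also have "\<dots> = (\<Sum>(\<alpha>, k)\<in>Sigma {..l} (\<lambda>\<alpha>. {k. \<alpha> + k \<le> l}). ?f \<alpha> k)"
    by (rule sum.Sigma) (auto intro: finite_subset[of _ "{..l}"])
  also have "\<dots> = star r (\<lambda>k. P (r - int k)) (\<lambda>k. Q (s - int k)) l"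
    unfolding star_def
    by (rule sum.reindex_bij_witness[where
          j = "\<lambda>(\<alpha>, k). (\<alpha>, k, l - \<alpha> - k)" and i = "\<lambda>(\<alpha>, k, j). (\<alpha>, k)"])
      (auto simp: triples_def)
  finally show ?thesis .
qed

lemma micro_mult_eq_0:
  assumes P: "vanishes_above r P" and Q: "vanishes_above s Q" and n: "n > r + s"
  shows "micro_mult P Q n = 0"
proof -
  have "(\<lambda>i. (d_t ^^ \<alpha>) P i * (d_eta ^^ \<alpha>) Q (n - i)) = (\<lambda>_. 0)" for \<alpha>
  proof
    fix i show "(d_t ^^ \<alpha>) P i * (d_eta ^^ \<alpha>) Q (n - i) = 0"
  proof (cases "i + int \<alpha> > r")
    case False
    then have "n - i > s" using n by simp
    then show ?thesis using Q by (simp add: d_eta_iter)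
  qed (simp add: d_t_iter P)
  qed
  then show ?thesis unfolding micro_mult_def comm_mult_def by (simp only:) simp
qed

lemma micro_mult_assoc:
  assumes P: "vanishes_above r P" and Q: "vanishes_above s Q" and W: "vanishes_above w W"
  shows "micro_mult (micro_mult P Q) W = micro_mult P (micro_mult Q W)"
proof
  fix n
  have PQ: "vanishes_above (r + s) (micro_mult P Q)" and QW: "vanishes_above (s + w) (micro_mult Q W)"
    using micro_mult_eq_0[OF P Q] micro_mult_eq_0[OF Q W] by simp_all
  show "micro_mult (micro_mult P Q) W n = micro_mult P (micro_mult Q W) n"
  proof (cases "n > r + s + w")
    case True
    then show ?thesis
      using micro_mult_eq_0[OF PQ W, of n] micro_mult_eq_0[OF P QW, of n] by simp
  next
    case False
    define l where "l = nat (r + s + w - n)"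
    have n: "n = r + s + w - int l" "n = r + (s + w) - int l" using False by (simp_all add: l_def)
    have "micro_mult (micro_mult P Q) W n = star (r + s) (\<lambda>k. micro_mult P Q (r + s - int k)) (\<lambda>k. W (w - int k)) l"
      unfolding n(1) by (rule micro_mult_eq_star[OF PQ W])
    also have "\<dots> = star r (\<lambda>k. P (r - int k)) (\<lambda>k. micro_mult Q W (s + w - int k)) l"
      unfolding micro_mult_eq_star[OF P Q] micro_mult_eq_star[OF Q W] by (rule star_assoc)
    also have "\<dots> = micro_mult P (micro_mult Q W) n"
      unfolding n(2) by (rule micro_mult_eq_star[OF P QW, symmetric])
    finally show ?thesis .
  qed
qed

lemma micro_mult_add_left:
  assumes P: "vanishes_above r P" "vanishes_above r P'" and Q: "vanishes_above s Q"
  shows "micro_mult (\<lambda>i. P i + P' i) Q = (\<lambda>i. micro_mult P Q i + micro_mult P' Q i)"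
proof
  fix n
  have PP: "vanishes_above r (\<lambda>i. P i + P' i)" using P by simp
  show "micro_mult (\<lambda>i. P i + P' i) Q n = micro_mult P Q n + micro_mult P' Q n"
  proof (cases "n > r + s")
    case True
    show ?thesis
      using micro_mult_eq_0[OF PP Q True] micro_mult_eq_0[OF P(1) Q True] micro_mult_eq_0[OF P(2) Q True] by simp
  next
    case False
    define l where "l = nat (r + s - n)"
    have n: "n = r + s - int l" using False by (simp add: l_def)
    show ?thesis
      unfolding n micro_mult_eq_star[OF PP Q] micro_mult_eq_star[OF P(1) Q] micro_mult_eq_star[OF P(2) Q]
      by (rule star_add_left)
  qed
qed

lemma micro_mult_add_right:
  assumes P: "vanishes_above r P" and Q: "vanishes_above s Q" "vanishes_above s Q'"
  shows "micro_mult P (\<lambda>i. Q i + Q' i) = (\<lambda>i. micro_mult P Q i + micro_mult P Q' i)"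
proof
  fix n
  have QQ: "vanishes_above s (\<lambda>i. Q i + Q' i)" using Q by simp
  show "micro_mult P (\<lambda>i. Q i + Q' i) n = micro_mult P Q n + micro_mult P Q' n"
  proof (cases "n > r + s")
    case True
    show ?thesis
      using micro_mult_eq_0[OF P QQ True] micro_mult_eq_0[OF P Q(1) True] micro_mult_eq_0[OF P Q(2) True] by simp
  next
    case False
    define l where "l = nat (r + s - n)"
    have n: "n = r + s - int l" using False by (simp add: l_def)
    show ?thesis
      unfolding n micro_mult_eq_star[OF P QQ] micro_mult_eq_star[OF P Q(1)] micro_mult_eq_star[OF P Q(2)]
      by (rule star_add_right)
  qed
qed

section \<open>Products with functions of eta, with t, and with constant coefficients\<close>

lemma micro_mult_monom_0_left: "micro_mult (micro_monom a 0) Q = (\<lambda>i. a * Q i)"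
proof
  fix n
  have "(d_t ^^ Suc \<alpha>) (micro_monom a 0) = (\<lambda>_. 0)" for \<alpha>
  proof
    fix i show "(d_t ^^ Suc \<alpha>) (micro_monom a 0) i = 0"
      unfolding d_t_iter by (cases "i + int (Suc \<alpha>) = 0") (simp_all only: micro_monom_def, simp_all)
  qed
  then have "comm_mult ((d_t ^^ Suc \<alpha>) (micro_monom a 0)) ((d_eta ^^ Suc \<alpha>) Q) n = 0" for \<alpha>
    by (simp only: comm_mult_def) simp
  then have "fps_const (1 / fact \<alpha>) * comm_mult ((d_t ^^ \<alpha>) (micro_monom a 0)) ((d_eta ^^ \<alpha>) Q) n = 0" if "\<alpha> \<noteq> 0" for \<alpha>
    using that by (metis not0_implies_Suc mult_zero_right)
  then show "micro_mult (micro_monom a 0) Q n = a * Q n"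
    unfolding micro_mult_def by (subst Sum_any_single[of 0]) (simp_all add: comm_mult_monom)
qed

text \<open>The rule t a = a t + a', to be matched with \<open>partial_lmult\<close>. The series
  over \<alpha> stops after \<alpha> = 1, because t has degree one.\<close>

lemma micro_mult_t_left: "micro_mult micro_t Q = (\<lambda>i. Q (i - 1) + fps_deriv (Q i))"
proof
  fix n
  have "(d_t ^^ Suc (Suc \<alpha>)) micro_t = (\<lambda>_. 0)" for \<alpha>
  proof
    fix i show "(d_t ^^ Suc (Suc \<alpha>)) micro_t i = 0"
      \<comment> \<open>Only exponent 1 carries a nonzero coefficient of t, and there the factor is
        1 choose \<alpha> + 2, which vanishes.\<close>
      unfolding d_t_iter using binomial_gbinomial[of 1 "Suc (Suc \<alpha>)", where 'a = complex]
      by (cases "i + int (Suc (Suc \<alpha>)) = 1") (simp_all only: micro_t_def micro_monom_def, simp_all)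
  qed
  then have "comm_mult ((d_t ^^ Suc (Suc \<alpha>)) micro_t) ((d_eta ^^ Suc (Suc \<alpha>)) Q) n = 0" for \<alpha>
    by (simp only: comm_mult_def) simp
  then have z: "comm_mult ((d_t ^^ \<alpha>) micro_t) ((d_eta ^^ \<alpha>) Q) n = 0" if "\<alpha> \<ge> 2" for \<alpha>
    using that by (metis add_2_eq_Suc le_Suc_ex)
  have d: "d_t micro_t = micro_monom 1 0" by (auto simp: d_t_def micro_t_def micro_monom_def)
  let ?f = "\<lambda>\<alpha>::nat. fps_const (1 / fact \<alpha>) * comm_mult ((d_t ^^ \<alpha>) micro_t) ((d_eta ^^ \<alpha>) Q) n"
  have "{\<alpha>. ?f \<alpha> \<noteq> 0} \<subseteq> {0, 1}" 
  proof
    fix \<alpha> assume "\<alpha> \<in> {\<alpha>. ?f \<alpha> \<noteq> 0}"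
    then have "\<not> 2 \<le> \<alpha>" using z[of \<alpha>] by auto
    then show "\<alpha> \<in> {0, 1}" by auto
  qed
  then have "Sum_any ?f = sum ?f {0, 1}" by (intro Sum_any.expand_superset) auto
  then show "micro_mult micro_t Q n = Q (n - 1) + fps_deriv (Q n)"
    by (simp add: micro_mult_def d comm_mult_monom) (simp add: micro_t_def comm_mult_monom d_eta_def)
qed

lemma micro_mult_const_right:
  assumes "\<And>i. fps_deriv (Q i) = 0"
  shows "micro_mult P Q = comm_mult P Q"
proof
  fix n
  have "(d_eta ^^ Suc \<alpha>) Q = (\<lambda>_. 0)" for \<alpha>
  proof
    fix i show "(d_eta ^^ Suc \<alpha>) Q i = 0"
      unfolding d_eta_iter funpow_Suc_right o_apply by (simp add: assms d_eta_def)
  qed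
  then have "comm_mult ((d_t ^^ Suc \<alpha>) P) ((d_eta ^^ Suc \<alpha>) Q) n = 0" for \<alpha>
    by (simp only: comm_mult_def) simp
  then have "fps_const (1 / fact \<alpha>) * comm_mult ((d_t ^^ \<alpha>) P) ((d_eta ^^ \<alpha>) Q) n = 0" if "\<alpha> \<noteq> 0" for \<alpha>
    using that by (metis not0_implies_Suc mult_zero_right)
  then show "micro_mult P Q n = comm_mult P Q n"
    unfolding micro_mult_def by (subst Sum_any_single[of 0]) simp_all
qed

section \<open>Growth of coefficients\<close>

lemma fact_mult_le: "fact a * fact b \<le> (fact (a + b) :: real)"
proof -
  have "fact a * fact b \<le> (fact (a + b) :: nat)"
    by (rule dvd_imp_le[OF fact_fact_dvd_fact]) simp
  then show ?thesis by (metis of_nat_fact of_nat_le_iff of_nat_mult)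
qed

lemma fact_add_le: "fact (a + b) \<le> 2 ^ (a + b) * fact a * (fact b :: real)"
proof -
  have "real ((a + b) choose a) \<le> 2 ^ (a + b)"
    using binomial_le_pow2[of "a + b" a] by (metis of_nat_le_iff of_nat_numeral of_nat_power)
  moreover have "fact (a + b) = real ((a + b) choose a) * fact a * fact b"
    using binomial_fact'[of a "a + b"] binomial_fact[of a "a + b", where 'a = real] by simp
  ultimately show ?thesis by (simp add: mult_right_mono)
qed

text \<open>For x = -(m + 1), upper negation gives the ordinary binomial coefficient m + n choose n
  up to sign; this case is responsible for the n in the exponent.\<close>

lemma norm_gbinomial_of_int_le: "norm ((of_int x :: complex) gchoose n) \<le> 2 ^ (nat \<bar>x\<bar> + n)"
proof (cases "x \<ge> 0")
  case True
  then obtain m where x: "x = int m" using nonneg_int_cases by blast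
  have "real (m choose n) \<le> 2 ^ m"
    using binomial_le_pow2[of m n] by (metis of_nat_le_iff of_nat_numeral of_nat_power)
  also have "\<dots> \<le> 2 ^ (m + n)" by (rule power_increasing) simp_all
  finally show ?thesis
    using binomial_gbinomial[of m n, where 'a = complex] by (simp add: x flip: binomial_gbinomial)
next
  case False
  then obtain m where x: "x = - int (Suc m)" by (metis not_less int_cases verit_comp_simplify1(3) of_nat_0_le_iff)
  have "(of_int x :: complex) gchoose n = (-1) ^ n * (of_nat (m + n) gchoose n)"
    using gbinomial_minus[of "of_nat (Suc m) :: complex" n] by (simp add: x)
  then have "norm ((of_int x :: complex) gchoose n) = real ((m + n) choose n)"
    by (simp add: norm_mult norm_power flip: binomial_gbinomial del: of_nat_add)
  also have "\<dots> \<le> 2 ^ (m + n)"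
    using binomial_le_pow2[of "m + n" n] by (metis of_nat_le_iff of_nat_numeral of_nat_power)
  also have "\<dots> \<le> 2 ^ (nat \<bar>x\<bar> + n)" by (rule power_increasing) (simp_all add: x)
  finally show ?thesis .
qed

lemma fps_nth_deriv_iter: "\<partial>\<^bsup>n\<^esup> f $ m = fact (m + n) / fact m * f $ (m + n)"
proof (induction n arbitrary: m)
  case (Suc n)
  have "\<partial>\<^bsup>Suc n\<^esup> f $ m = of_nat (Suc m) * (fact (Suc m + n) / fact (Suc m) * f $ (Suc m + n))"
    by (simp add: Suc)
  also have "\<dots> = fact (m + Suc n) / fact m * f $ (m + Suc n)"
    by (simp add: divide_simps del: of_nat_Suc)
  finally show ?case .
qed simp

lemma norm_fps_nth_deriv_iter_le:
  "norm (\<partial>\<^bsup>n\<^esup> f $ m) \<le> 2 ^ (m + n) * fact n * norm (f $ (m + n))"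
proof -
  have "fact (m + n) / fact m \<le> 2 ^ (m + n) * (fact n :: real)"
    using fact_add_le[of m n] by (simp add: divide_simps mult_ac)
  from mult_right_mono[OF this, of "norm (f $ (m + n))"] show ?thesis
    by (simp add: fps_nth_deriv_iter norm_mult norm_divide norm_fact)
qed

text \<open>By Cauchy's inequalities, the analytic condition in \<^const>\<open>micro_carrier\<close> amounts to a
  condition on the double sequence of Taylor coefficients, in which the radii \<open>\<rho>\<^sub>0\<close>, \<open>\<rho>\<close> and
  \<open>\<theta>\<close> are absorbed by a single constant.\<close>

definition coeff_bound :: "int \<Rightarrow> real \<Rightarrow> fsum \<Rightarrow> bool" where
  "coeff_bound r A P \<longleftrightarrow> A \<ge> 1 \<and> vanishes_above r P \<and>
     (\<forall>k m. norm (P (r - int k) $ m) \<le> A ^ (k + m + 1) * fact k)"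

text \<open>Raising the order from r to r' renumbers the coefficients: number k becomes number k -
  (r' - r). As \<open>A\<close> is at least 1, the permitted bound increases with k, so the estimate
  survives.\<close>

lemma coeff_bound_mono:
  assumes "coeff_bound r A P" "r \<le> r'" "A \<le> A'"
  shows "coeff_bound r' A' P"
  unfolding coeff_bound_def
proof (intro conjI allI impI)
  have A: "A \<ge> 1" and P: "vanishes_above r P"
    and b: "norm (P (r - int k) $ m) \<le> A ^ (k + m + 1) * fact k" for k m
    using assms(1) unfolding coeff_bound_def by auto
  show "A' \<ge> 1" using A assms by simp
  show "P i = 0" if "i > r'" for i using that P assms by simp
  fix k m
  show "norm (P (r' - int k) $ m) \<le> A' ^ (k + m + 1) * fact k"
  proof (cases "r' - int k > r")
    case True
    then show ?thesis using P A assms by simp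
  next
    case False
    define k' where "k' = nat (r - (r' - int k))"
    have k': "r' - int k = r - int k'" "k' \<le> k" using False assms by (auto simp: k'_def)
    have "norm (P (r' - int k) $ m) \<le> A ^ (k' + m + 1) * fact k'" unfolding k' by (rule b)
    also have "\<dots> \<le> A' ^ (k + m + 1) * fact k"
    proof (intro mult_mono fact_mono k')
      have "A ^ (k' + m + 1) \<le> A ^ (k + m + 1)" using A k' by (intro power_increasing) auto
      also have "\<dots> \<le> A' ^ (k + m + 1)" using A assms by (intro power_mono) auto
      finally show "A ^ (k' + m + 1) \<le> A' ^ (k + m + 1)" .
    qed (use A assms in auto)
    finally show ?thesis .
  qed
qed

section \<open>Taylor coefficients against suprema on discs\<close>

lemma fps_conv_radius_geI:
  assumes "A > 0" "\<And>m. norm (f $ m) \<le> C * A ^ m"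
  shows "fps_conv_radius f \<ge> ereal (1 / A)"
  unfolding fps_conv_radius_def
proof (rule conv_radius_geI_ex')
  fix r assume r: "0 < r" "ereal r < ereal (1 / A)"
  then have "A * r < 1" using assms(1) by (simp add: field_simps)
  then have "summable (\<lambda>m. C * (A * r) ^ m)"
    using r assms(1) by (intro summable_mult summable_geometric) auto
  then show "summable (\<lambda>m. f $ m * of_real r ^ m)"
  proof (rule summable_comparison_test'[where N = 0])
    fix m
    show "norm (f $ m * of_real r ^ m) \<le> C * (A * r) ^ m"
      using mult_right_mono[OF assms(2)[of m], of "r ^ m"] r
      by (simp add: norm_mult norm_power power_mult_distrib mult_ac)
  qed
qed

lemma norm_eval_fps_le:
  assumes A: "A > 0" and f: "\<And>m. norm (f $ m) \<le> C * A ^ m" and z: "norm z \<le> 1 / (2 * A)"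
  shows "norm (eval_fps f z) \<le> 2 * C"
proof -
  have le: "norm (f $ m * z ^ m) \<le> C * (1 / 2) ^ m" for m
  proof -
    have "C * A ^ m \<ge> 0" using f[of m] norm_ge_zero order_trans by blast
    then have "norm (f $ m * z ^ m) \<le> (C * A ^ m) * (1 / (2 * A)) ^ m"
      unfolding norm_mult norm_power using f z by (intro mult_mono power_mono) auto
    also have "\<dots> = C * (1 / 2) ^ m" using A by (simp add: power_divide power_mult_distrib)
    finally show ?thesis .
  qed
  have s: "(\<lambda>m. C * (1 / 2 :: real) ^ m) sums (C * (1 / (1 - 1 / 2)))"
    by (intro sums_mult geometric_sums) simp
  have "norm (eval_fps f z) \<le> suminf (\<lambda>m. C * (1 / 2 :: real) ^ m)"
    unfolding eval_fps_def using norm_suminf_le[OF le sums_summable[OF s]] .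
  then show ?thesis using sums_unique[OF s] by simp
qed

lemma cball_subset_eball: "ereal \<rho> < R \<Longrightarrow> cball 0 \<rho> \<subseteq> eball (0 :: complex) R"
  by (auto simp: in_eball_iff) (meson ereal_less_eq(3) le_less_trans)

lemma norm_eval_fps_le_sup_norm:
  assumes "ereal \<rho> < fps_conv_radius f" "norm z \<le> \<rho>"
  shows "norm (eval_fps f z) \<le> sup_norm \<rho> f"
  unfolding sup_norm_def
proof (rule cSUP_upper)
  have "continuous_on (cball 0 \<rho>) (eval_fps f)"
    by (rule continuous_on_subset[OF continuous_on_eval_fps cball_subset_eball[OF assms(1)]])
  then have "compact ((\<lambda>z. norm (eval_fps f z)) ` cball 0 \<rho>)"
    by (intro compact_continuous_image continuous_on_norm) auto
  then show "bdd_above ((\<lambda>z. norm (eval_fps f z)) ` cball 0 \<rho>)"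
    by (intro bounded_imp_bdd_above compact_imp_bounded)
qed (use assms in auto)

lemma norm_fps_nth_le_sup_norm:
  assumes "\<rho> > 0" "ereal \<rho> < fps_conv_radius f"
  shows "norm (f $ m) \<le> sup_norm \<rho> f / \<rho> ^ m"
proof -
  have sub: "cball (0 :: complex) \<rho> \<subseteq> eball 0 (fps_conv_radius f)"
    by (rule cball_subset_eball[OF assms(2)])
  have "norm ((deriv ^^ m) (eval_fps f) 0) \<le> fact m * sup_norm \<rho> f / \<rho> ^ m"
  proof (rule Cauchy_inequality)
    show "eval_fps f holomorphic_on ball 0 \<rho>"
      by (rule holomorphic_on_eval_fps) (use sub ball_subset_cball in blast)
    show "continuous_on (cball 0 \<rho>) (eval_fps f)"
      by (rule continuous_on_subset[OF continuous_on_eval_fps sub])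
  qed (use assms norm_eval_fps_le_sup_norm in auto)
  then have le: "norm ((deriv ^^ m) (eval_fps f) 0) / fact m \<le> fact m * sup_norm \<rho> f / \<rho> ^ m / fact m"
    by (rule divide_right_mono) simp
  have "0 < fps_conv_radius f" using assms by (metis ereal_less(2) less_trans)
  then have "norm (f $ m) = norm ((deriv ^^ m) (eval_fps f) 0) / fact m"
    by (simp add: fps_nth_conv_deriv norm_divide norm_fact)
  also note le
  also have "fact m * sup_norm \<rho> f / \<rho> ^ m / fact m = sup_norm \<rho> f / \<rho> ^ m" by simp
  finally show ?thesis .
qed

lemma sup_norm_nonneg:
  assumes "\<rho> > 0" "ereal \<rho> < fps_conv_radius f" shows "sup_norm \<rho> f \<ge> 0"
proof -
  have "norm (eval_fps f 0) \<le> sup_norm \<rho> f"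
    by (rule norm_eval_fps_le_sup_norm[OF assms(2)]) (use assms(1) in simp)
  then show ?thesis using norm_ge_zero order_trans by blast
qed

lemma micro_carrier_if_coeff_bound:
  assumes "coeff_bound r A P" shows "P \<in> micro_carrier"
proof -
  \<comment> \<open>With a nonnegative top order, the coefficient of t^(-k) is number k + R in the
    bound, without case distinction.\<close>
  define R where "R = nat \<bar>r\<bar>"
  have "coeff_bound (int R) A P" by (rule coeff_bound_mono[OF assms]) (auto simp: R_def)
  then have A: "A \<ge> 1" and P: "vanishes_above (int R) P"
    and b: "\<And>k m. norm (P (int R - int k) $ m) \<le> A ^ (k + m + 1) * fact k"
    unfolding coeff_bound_def by auto
  have b': "norm (P (int R - int k) $ m) \<le> (A ^ (k + 1) * fact k) * A ^ m" for k m
    using b[of k m] by (simp add: power_add mult_ac)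
  have radius: "ereal (1 / A) \<le> fps_conv_radius (P i)" for i
  proof (cases "i > int R")
    case False
    then have "i = int R - int (nat (int R - i))" by simp
    then show ?thesis using fps_conv_radius_geI[of A "P i"] A b' by (metis less_le_trans zero_less_one)
  qed (use P in simp)
  \<comment> \<open>Half of the guaranteed radius 1 / A, so that the Taylor series is dominated by a
    geometric series of ratio 1/2. In \<theta> one further factor 2 compensates the estimate of (k +
    R)! by 2^(k + R) k! R!, leaving 2 A \<theta> = 1/2.\<close>
  define \<rho> where "\<rho> = 1 / (2 * A)"
  define \<theta> where "\<theta> = 1 / (4 * A)"
  have \<rho>: "0 < \<rho>" "\<rho> < 1 / A" and \<theta>: "0 < \<theta>" using A by (simp_all add: \<rho>_def \<theta>_def field_simps)
  have sup: "sup_norm \<rho> (P (int R - int k)) \<le> 2 * (A ^ (k + 1) * fact k)" for k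
    unfolding sup_norm_def
  proof (rule cSUP_least)
    show "norm (eval_fps (P (int R - int k)) z) \<le> 2 * (A ^ (k + 1) * fact k)" if "z \<in> cball 0 \<rho>" for z
      using norm_eval_fps_le[of A "P (int R - int k)" "A ^ (k + 1) * fact k" z] b' A that by (simp add: \<rho>_def)
  qed (use \<rho> in auto)
  define C where "C = 2 * A ^ (R + 1) * 2 ^ R * fact R"
  have "summable (\<lambda>k. C * (1 / 2) ^ k)" by (intro summable_mult summable_geometric) simp
  then have "summable (\<lambda>k. sup_norm \<rho> (P (- int k)) * (\<theta> ^ k / fact k))"
  proof (rule summable_comparison_test'[where N = 0])
    fix k
    have nn: "sup_norm \<rho> (P (- int k)) \<ge> 0"
      by (rule sup_norm_nonneg[OF \<rho>(1) less_le_trans[OF _ radius]]) (use \<rho> in simp)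
    have "sup_norm \<rho> (P (- int k)) \<le> 2 * (A ^ (k + R + 1) * fact (k + R))"
      using sup[of "k + R"] by simp
    also have "\<dots> \<le> 2 * (A ^ (k + R + 1) * (2 ^ (k + R) * fact k * fact R))"
      using A by (intro mult_left_mono fact_add_le) auto
    also have "\<dots> = C * (2 * A) ^ k * fact k" by (simp add: C_def power_add power_mult_distrib)
    finally have "sup_norm \<rho> (P (- int k)) * (\<theta> ^ k / fact k) \<le> C * (2 * A) ^ k * fact k * (\<theta> ^ k / fact k)"
      using \<theta> by (intro mult_right_mono) auto
    also have "\<dots> = C * (2 * A * \<theta>) ^ k" by (simp add: power_mult_distrib)
    also have "2 * A * \<theta> = 1 / 2" using A by (simp add: \<theta>_def)
    finally show "norm (sup_norm \<rho> (P (- int k)) * (\<theta> ^ k / fact k)) \<le> C * (1 / 2) ^ k"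
      using nn \<theta> by simp
  qed
  with \<rho> \<theta> have "\<exists>\<rho> \<theta>. 0 < \<rho> \<and> \<rho> < 1 / A \<and> 0 < \<theta> \<and>
      summable (\<lambda>k. sup_norm \<rho> (P (- int k)) * (\<theta> ^ k / fact k))" by blast
  moreover have "0 < 1 / A" using A by simp
  ultimately show ?thesis
    unfolding micro_carrier_def using P radius by blast
qed

lemma coeff_bound_if_micro_carrier:
  assumes "P \<in> micro_carrier" shows "\<exists>r A. coeff_bound r A P"
proof -
  obtain r \<rho>\<^sub>0 \<rho> \<theta> where r: "vanishes_above r P" and radius: "\<And>i. ereal \<rho>\<^sub>0 \<le> fps_conv_radius (P i)"
    and \<rho>: "0 < \<rho>" "\<rho> < \<rho>\<^sub>0" and \<theta>: "0 < \<theta>"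
    and summable: "summable (\<lambda>k. sup_norm \<rho> (P (- int k)) * (\<theta> ^ k / fact k))"
    using assms unfolding micro_carrier_def by auto
  define R where "R = nat \<bar>r\<bar>"
  have P: "vanishes_above (int R) P" using r by (simp add: R_def)
  have rad: "ereal \<rho> < fps_conv_radius (P i)" for i
    using radius[of i] \<rho> by (metis ereal_less_eq(3) less_ereal.simps(1) less_le_trans)
  \<comment> \<open>Boundedness of the terms already yields an estimate of the form C (1/\<theta>)^k
    k!.\<close>
  have "bounded (range (\<lambda>k. sup_norm \<rho> (P (- int k)) * (\<theta> ^ k / fact k)))"
    using summable_LIMSEQ_zero[OF summable] convergent_imp_bounded by blast
  then obtain C where C: "\<And>k. norm (sup_norm \<rho> (P (- int k)) * (\<theta> ^ k / fact k)) \<le> C"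
    unfolding bounded_iff by auto
  \<comment> \<open>The series says nothing about positive powers of t; these are finitely many and
    are covered by a maximum. In \<open>A\<close>, the entries 1/\<theta> and 1/\<rho> serve as
    geometric ratios, \<open>C\<close> and \<open>D\<close> as prefactors, and 1 makes powers
    monotone.\<close>
  define D where "D = Max ((\<lambda>k. sup_norm \<rho> (P (int R - int k))) ` {..R})"
  define A where "A = Max {1, 1 / \<theta>, 1 / \<rho>, C, D}"
  have A: "1 \<le> A" "1 / \<theta> \<le> A" "1 / \<rho> \<le> A" "C \<le> A" "D \<le> A" unfolding A_def by auto
  have sup: "sup_norm \<rho> (P (int R - int k)) \<le> A ^ (k + 1) * fact k" for k
  proof (cases "k \<le> R")
    case True
    then have "sup_norm \<rho> (P (int R - int k)) \<le> D" unfolding D_def by (intro Max_ge) auto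
    also have "\<dots> \<le> A ^ 1 * 1" using A by simp
    also have "\<dots> \<le> A ^ (k + 1) * fact k"
      using A by (intro mult_mono power_increasing) (auto simp: fact_ge_1)
    finally show ?thesis .
  next
    case False
    define j where "j = k - R"
    have j: "int R - int k = - int j" "j \<le> k" using False by (auto simp: j_def)
    have "sup_norm \<rho> (P (- int j)) * (\<theta> ^ j / fact j) \<le> C" 
      by (rule order_trans[OF abs_ge_self C[of j, unfolded real_norm_def]])
    then have "sup_norm \<rho> (P (- int j)) \<le> C * (1 / \<theta>) ^ j * fact j"
      using \<theta> by (simp add: divide_simps power_divide mult_ac)
    also have "\<dots> \<le> A * A ^ j * fact j"
      using A \<theta> by (intro mult_right_mono mult_mono power_mono) auto
    also have "\<dots> = A ^ (j + 1) * fact j" by simp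
    also have "\<dots> \<le> A ^ (k + 1) * fact k"
      using A j by (intro mult_mono power_increasing fact_mono) auto
    finally show ?thesis by (simp add: j)
  qed
  have "norm (P (int R - int k) $ m) \<le> A ^ (k + m + 1) * fact k" for k m
  proof -
    have "norm (P (int R - int k) $ m) \<le> sup_norm \<rho> (P (int R - int k)) * (1 / \<rho>) ^ m"
      using norm_fps_nth_le_sup_norm[OF \<rho>(1) rad] by (simp add: power_divide)
    also have "\<dots> \<le> (A ^ (k + 1) * fact k) * A ^ m"
      using sup A \<rho> by (intro mult_mono power_mono) auto
    finally show ?thesis by (simp add: power_add mult_ac)
  qed
  then show ?thesis using P A unfolding coeff_bound_def by blast
qed

lemma micro_carrier_iff_coeff_bound: "P \<in> micro_carrier \<longleftrightarrow> (\<exists>r A. coeff_bound r A P)"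
  using micro_carrier_if_coeff_bound coeff_bound_if_micro_carrier by blast

section \<open>Growth of the coefficients of a product\<close>

lemma card_triples_le: "real (card (triples l)) \<le> 4 ^ l"
proof -
  have "card (triples l) \<le> card ({..l} \<times> {..l})"
    by (rule order_trans[OF card_mono[OF _ triples_subset] card_image_le]) auto
  also have "\<dots> = (l + 1) * (l + 1)" by (simp add: card_cartesian_product)
  also have "\<dots> \<le> 2 ^ l * 2 ^ l" using less_exp[of l] by (intro mult_mono) (simp_all add: Suc_le_eq)
  also have "\<dots> = 4 ^ l" by (simp flip: power_mult_distrib)
  finally show ?thesis by (metis of_nat_le_iff of_nat_numeral of_nat_power)
qed

text \<open>The binomial coefficient contributes 2^(|r| + l), the derivatives 2^(m + l) \<alpha>!,
  and the Cauchy product has m + 1 \<le> 2^m terms. The exponents i + u + 1 and j + (m - u +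
  \<alpha>) + 1 of \<open>A\<close> add up to l + m + 2, and \<alpha>! i! j! \<le> l! because the
  indices sum to l.\<close>

lemma norm_star_term_le:
  assumes A: "A \<ge> 1" and l: "\<alpha> + i + j = l"
    and p: "\<And>k m. norm (p k $ m) \<le> A ^ (k + m + 1) * fact k"
    and q: "\<And>k m. norm (q k $ m) \<le> A ^ (k + m + 1) * fact k"
  shows "norm ((fps_const (of_int (r - int i) gchoose \<alpha>) * (p i * \<partial>\<^bsup>\<alpha>\<^esup> (q j))) $ m)
    \<le> 2 ^ m * (2 ^ (nat \<bar>r\<bar> + 2 * l + m) * A ^ (l + m + 2) * fact l)"
proof -
  let ?R = "nat \<bar>r\<bar>"
  let ?B = "2 ^ (?R + 2 * l + m) * A ^ (l + m + 2) * fact l"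
  have g: "norm ((of_int (r - int i) :: complex) gchoose \<alpha>) \<le> 2 ^ (?R + l)"
    by (rule order_trans[OF norm_gbinomial_of_int_le power_increasing]) (use l in auto)
  have t: "norm ((of_int (r - int i) gchoose \<alpha>) * (p i $ u * \<partial>\<^bsup>\<alpha>\<^esup> (q j) $ (m - u))) \<le> ?B" if u: "u \<le> m" for u
  proof -
    have "norm (\<partial>\<^bsup>\<alpha>\<^esup> (q j) $ (m - u)) \<le> 2 ^ (m - u + \<alpha>) * fact \<alpha> * (A ^ (j + (m - u + \<alpha>) + 1) * fact j)"
      using A by (intro order_trans[OF norm_fps_nth_deriv_iter_le] mult_left_mono q) auto
    also have "\<dots> \<le> 2 ^ (m + l) * fact \<alpha> * (A ^ (j + (m - u + \<alpha>) + 1) * fact j)"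
      using A l by (intro mult_right_mono power_increasing) auto
    finally have "norm ((of_int (r - int i) gchoose \<alpha>) * (p i $ u * \<partial>\<^bsup>\<alpha>\<^esup> (q j) $ (m - u)))
      \<le> 2 ^ (?R + l) * ((A ^ (i + u + 1) * fact i) * (2 ^ (m + l) * fact \<alpha> * (A ^ (j + (m - u + \<alpha>) + 1) * fact j)))"
      unfolding norm_mult using A by (intro mult_mono g p) auto
    also have "\<dots> = 2 ^ (?R + l) * 2 ^ (m + l) * (A ^ (i + u + 1) * A ^ (j + (m - u + \<alpha>) + 1)) * (fact \<alpha> * fact i * fact j)"
      by (simp only: mult_ac)
    also have "A ^ (i + u + 1) * A ^ (j + (m - u + \<alpha>) + 1) = A ^ (l + m + 2)"
      unfolding power_add[symmetric] using l u by (intro arg_cong[of _ _ "power A"]) simp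
    also have "2 ^ (?R + l) * 2 ^ (m + l) = (2 ^ (?R + 2 * l + m) :: real)"
      unfolding power_add[symmetric] by (intro arg_cong[of _ _ "power 2"]) simp
    also have "2 ^ (?R + 2 * l + m) * A ^ (l + m + 2) * (fact \<alpha> * fact i * fact j) \<le> ?B"
    proof -
      have "fact \<alpha> * fact i * fact j \<le> fact (\<alpha> + i) * (fact j :: real)"
        by (intro mult_right_mono fact_mult_le) simp
      also have "\<dots> \<le> fact l" using fact_mult_le[of "\<alpha> + i" j] l by simp
      finally show ?thesis using A by (intro mult_left_mono) auto
    qed
    finally show ?thesis .
  qed
  have "norm ((fps_const (of_int (r - int i) gchoose \<alpha>) * (p i * \<partial>\<^bsup>\<alpha>\<^esup> (q j))) $ m)
      = norm (\<Sum>u\<le>m. (of_int (r - int i) gchoose \<alpha>) * (p i $ u * \<partial>\<^bsup>\<alpha>\<^esup> (q j) $ (m - u)))"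
    unfolding fps_mult_left_const_nth fps_mult_nth[of "p i"] by (simp add: atMost_atLeast0 sum_distrib_left)
  also have "\<dots> \<le> of_nat (card {..m}) * ?B"
    by (rule sum_norm_bound) (use t in auto)
  also have "\<dots> \<le> 2 ^ m * ?B"
  proof (rule mult_right_mono)
    have "Suc m \<le> 2 ^ m" using less_exp[of m] by (simp add: Suc_le_eq)
    then show "real (card {..m}) \<le> 2 ^ m" by (metis card_atMost of_nat_le_iff of_nat_numeral of_nat_power)
  qed (use A in auto)
  finally show ?thesis .
qed

text \<open>The target shape has one base, so each factor is absorbed by raising it to the power l +
  m + 1. The number of triples and the powers of 2 give 2^(4l + 2m), whence 16; the extra
  \<open>A\<close> in A^(l + m + 2) is the reason for squaring \<open>A\<close>.\<close>

lemma norm_star_le: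
  assumes A: "A \<ge> 1"
    and p: "\<And>k m. norm (p k $ m) \<le> A ^ (k + m + 1) * fact k"
    and q: "\<And>k m. norm (q k $ m) \<le> A ^ (k + m + 1) * fact k"
  shows "norm (star r p q l $ m) \<le> (2 ^ (nat \<bar>r\<bar>) * 16 * A ^ 2) ^ (l + m + 1) * fact l"
proof -
  let ?R = "nat \<bar>r\<bar>"
  let ?B = "2 ^ m * (2 ^ (?R + 2 * l + m) * A ^ (l + m + 2) * fact l)"
  have "norm (star r p q l $ m) \<le> of_nat (card (triples l)) * ?B"
    unfolding star_def fps_sum_nth
  proof (rule sum_norm_bound)
    fix x assume "x \<in> triples l"
    then obtain \<alpha> i j where x: "x = (\<alpha>, i, j)" "\<alpha> + i + j = l" by (auto simp: triples_def)
    show "norm ((case x of (\<alpha>, i, j) \<Rightarrow> fps_const (of_int (r - int i) gchoose \<alpha>) * (p i * \<partial>\<^bsup>\<alpha>\<^esup> (q j))) $ m) \<le> ?B"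
      unfolding x(1) prod.case by (rule norm_star_term_le[OF A x(2) p q])
  qed
  also have "\<dots> \<le> 4 ^ l * ?B"
    using A by (intro mult_right_mono card_triples_le) auto
  also have "\<dots> = 2 ^ ?R * (4 ^ l * 2 ^ m * 2 ^ (2 * l + m)) * A ^ (l + m + 2) * fact l"
    by (simp add: power_add mult_ac)
  also have "\<dots> \<le> (2 ^ ?R) ^ (l + m + 1) * 16 ^ (l + m + 1) * (A ^ 2) ^ (l + m + 1) * fact l"
  proof (intro mult_right_mono mult_mono)
    show "(2 :: real) ^ ?R \<le> (2 ^ ?R) ^ (l + m + 1)"
      unfolding power_mult[symmetric] by (rule power_increasing) auto
    have "(4 :: real) ^ l * 2 ^ m * 2 ^ (2 * l + m) = 2 ^ (4 * l + 2 * m)"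
    proof -
      have "(4 :: real) ^ l = 2 ^ (2 * l)" by (simp add: power_mult)
      then show ?thesis by (simp flip: power_add)
    qed
    also have "\<dots> \<le> 2 ^ (4 * (l + m + 1))" by (rule power_increasing) auto
    also have "\<dots> = 16 ^ (l + m + 1)" by (simp only: power_mult) simp
    finally show "(4 :: real) ^ l * 2 ^ m * 2 ^ (2 * l + m) \<le> 16 ^ (l + m + 1)" .
    show "A ^ (l + m + 2) \<le> (A ^ 2) ^ (l + m + 1)"
      unfolding power_mult[symmetric] using A by (intro power_increasing) auto
  qed (use A in auto)
  also have "\<dots> = (2 ^ ?R * 16 * A ^ 2) ^ (l + m + 1) * fact l"
    by (simp only: power_mult_distrib)
  finally show ?thesis .
qed

section \<open>The ring of microdifferential operators\<close>

lemma coeff_bound_mult: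
  assumes P: "coeff_bound r A P" and Q: "coeff_bound s A Q"
  shows "coeff_bound (r + s) (2 ^ (nat \<bar>r\<bar>) * 16 * A ^ 2) (micro_mult P Q)"
  unfolding coeff_bound_def
proof (intro conjI allI)
  have A: "A \<ge> 1" and vP: "vanishes_above r P" and vQ: "vanishes_above s Q"
    using P Q unfolding coeff_bound_def by auto
  have "1 * 1 * 1 \<le> 2 ^ (nat \<bar>r\<bar>) * 16 * A ^ 2"
    using A by (intro mult_mono) (auto simp: one_le_power)
  then show "1 \<le> 2 ^ (nat \<bar>r\<bar>) * 16 * A ^ 2" by simp
  show "r + s < n \<longrightarrow> micro_mult P Q n = 0" for n using micro_mult_eq_0[OF vP vQ] by blast
  show "norm (micro_mult P Q (r + s - int l) $ m) \<le> (2 ^ (nat \<bar>r\<bar>) * 16 * A ^ 2) ^ (l + m + 1) * fact l" for l m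
    unfolding micro_mult_eq_star[OF vP vQ]
    by (rule norm_star_le[OF A]) (use P Q in \<open>auto simp: coeff_bound_def\<close>)
qed

lemma coeff_bound_common:
  assumes "P \<in> micro_carrier" "Q \<in> micro_carrier"
  obtains r A where "coeff_bound r A P" "coeff_bound r A Q"
proof -
  obtain r A s B where "coeff_bound r A P" "coeff_bound s B Q"
    using assms unfolding micro_carrier_iff_coeff_bound by blast
  then show thesis
    by (intro that[of "max r s" "max A B"]) (auto elim: coeff_bound_mono)
qed

lemma micro_mult_closed: "P \<in> micro_carrier \<Longrightarrow> Q \<in> micro_carrier \<Longrightarrow> micro_mult P Q \<in> micro_carrier"
  by (metis coeff_bound_common coeff_bound_mult micro_carrier_if_coeff_bound)

lemma micro_add_closed:
  assumes "P \<in> micro_carrier" "Q \<in> micro_carrier"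
  shows "(\<lambda>i. P i + Q i) \<in> micro_carrier"
proof -
  obtain r A where P: "coeff_bound r A P" and Q: "coeff_bound r A Q" by (rule coeff_bound_common[OF assms])
  have A: "A \<ge> 1" using P by (simp add: coeff_bound_def)
  have "norm ((P (r - int k) + Q (r - int k)) $ m) \<le> (2 * A) ^ (k + m + 1) * fact k" for k m
  proof -
    have "norm ((P (r - int k) + Q (r - int k)) $ m) \<le> norm (P (r - int k) $ m) + norm (Q (r - int k) $ m)"
      by (simp add: norm_triangle_ineq)
    also have "\<dots> \<le> A ^ (k + m + 1) * fact k + A ^ (k + m + 1) * fact k"
      using P Q unfolding coeff_bound_def by (intro add_mono) blast+
    also have "\<dots> = 2 * A ^ (k + m + 1) * fact k" by simp
    also have "\<dots> \<le> 2 ^ (k + m + 1) * A ^ (k + m + 1) * fact k"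
      using A by (intro mult_right_mono self_le_power) auto
    finally show ?thesis by (simp only: power_mult_distrib)
  qed
  then have "coeff_bound r (2 * A) (\<lambda>i. P i + Q i)" using P Q A by (simp add: coeff_bound_def)
  then show ?thesis by (rule micro_carrier_if_coeff_bound)
qed

lemma micro_uminus_closed:
  assumes "P \<in> micro_carrier" shows "(\<lambda>i. - P i) \<in> micro_carrier"
proof -
  obtain r A where "coeff_bound r A P" using assms micro_carrier_iff_coeff_bound by blast
  then have "coeff_bound r A (\<lambda>i. - P i)" unfolding coeff_bound_def by simp
  then show ?thesis by (rule micro_carrier_if_coeff_bound)
qed

section \<open>Membership of finite sums and the ring axioms\<close>

lemma sup_norm_0: "\<rho> \<ge> 0 \<Longrightarrow> sup_norm \<rho> 0 = 0"
  by (simp add: sup_norm_def)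

lemma ereal_pos_lower_bound:
  assumes "finite S" "\<And>x. x \<in> S \<Longrightarrow> (0 :: ereal) < f x"
  obtains \<rho> where "0 < \<rho>" "\<And>x. x \<in> S \<Longrightarrow> ereal \<rho> \<le> f x"
proof -
  \<comment> \<open>The value 1 keeps the minimum meaningful when \<open>S\<close> is empty.\<close>
  have "0 < Min (insert 1 (f ` S))" using assms by (subst Min_gr_iff) auto
  then obtain \<rho> where \<rho>: "0 < ereal \<rho>" "ereal \<rho> < Min (insert 1 (f ` S))" using ereal_dense2 by blast
  have "ereal \<rho> \<le> f x" if "x \<in> S" for x
  proof -
    have "Min (insert 1 (f ` S)) \<le> f x" using assms(1) that by (intro Min_le) auto
    then show ?thesis using \<rho>(2) by simp
  qed
  then show thesis using \<rho>(1) by (intro that[of \<rho>]) auto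
qed

text \<open>Finitely many nonzero coefficients share a positive radius, and the series in the growth
  condition is a finite sum, so any \<theta> will do.\<close>

lemma micro_carrier_finite:
  assumes fin: "finite {i. P i \<noteq> 0}" and radius: "\<And>i. 0 < fps_conv_radius (P i)"
  shows "P \<in> micro_carrier"
proof -
  obtain \<rho>\<^sub>0 where \<rho>\<^sub>0: "0 < \<rho>\<^sub>0" "\<And>i. i \<in> {i. P i \<noteq> 0} \<Longrightarrow> ereal \<rho>\<^sub>0 \<le> fps_conv_radius (P i)"
    using ereal_pos_lower_bound[OF fin, of "\<lambda>i. fps_conv_radius (P i)"] radius by blast
  have rad: "\<forall>i. ereal \<rho>\<^sub>0 \<le> fps_conv_radius (P i)"
  proof
    fix i show "ereal \<rho>\<^sub>0 \<le> fps_conv_radius (P i)" using \<rho>\<^sub>0(2)[of i] by (cases "P i = 0") auto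
  qed
  obtain r where r: "\<And>i. i \<in> {i. P i \<noteq> 0} \<Longrightarrow> i \<le> r"
    using bdd_above_finite[OF fin] unfolding bdd_above_def by blast
  have va: "\<exists>r. vanishes_above r P" using r by (intro exI[of _ r]) force
  have "summable (\<lambda>k. sup_norm (\<rho>\<^sub>0 / 2) (P (- int k)) * (1 ^ k / fact k))"
  proof (rule summable_finite[of "(\<lambda>i. nat (- i)) ` {i. P i \<noteq> 0}"])
    fix k :: nat assume "k \<notin> (\<lambda>i. nat (- i)) ` {i. P i \<noteq> 0}"
    then have "P (- int k) = 0" by (auto simp: image_iff)
    then show "sup_norm (\<rho>\<^sub>0 / 2) (P (- int k)) * (1 ^ k / fact k) = 0" using \<rho>\<^sub>0(1) by (simp add: sup_norm_0)
  qed (use fin in simp)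
  moreover have "0 < \<rho>\<^sub>0 / 2" "\<rho>\<^sub>0 / 2 < \<rho>\<^sub>0" using \<rho>\<^sub>0(1) by simp_all
  ultimately have "\<exists>\<rho> \<theta>. 0 < \<rho> \<and> \<rho> < \<rho>\<^sub>0 \<and> 0 < \<theta> \<and>
      summable (\<lambda>k. sup_norm \<rho> (P (- int k)) * (\<theta> ^ k / fact k))"
    by (intro exI[of _ "\<rho>\<^sub>0 / 2"] exI[of _ "1 :: real"]) simp
  then show ?thesis using va rad \<rho>\<^sub>0(1) unfolding micro_carrier_def by blast
qed

lemma micro_monom_closed:
  assumes "0 < fps_conv_radius a" shows "micro_monom a i \<in> micro_carrier"
proof (rule micro_carrier_finite)
  show "finite {j. micro_monom a i j \<noteq> 0}"
    by (rule finite_subset[of _ "{i}"]) (auto simp: micro_monom_def)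
qed (simp add: micro_monom_def assms)

lemma Micro_simps [simp]:
  "carrier Micro = micro_carrier" "P \<otimes>\<^bsub>Micro\<^esub> Q = micro_mult P Q"
  "P \<oplus>\<^bsub>Micro\<^esub> Q = (\<lambda>i. P i + Q i)" "\<zero>\<^bsub>Micro\<^esub> = (\<lambda>_. 0)" "\<one>\<^bsub>Micro\<^esub> = micro_monom 1 0"
  by (simp_all add: Micro_def)

lemma comm_mult_monom_right: "comm_mult P (micro_monom a j) = (\<lambda>n. P (n - j) * a)"
  unfolding comm_mult_def
proof
  fix n
  show "Sum_any (\<lambda>i. P i * micro_monom a j (n - i)) = P (n - j) * a"
    by (subst Sum_any_single[of "n - j"]) (auto simp: micro_monom_def)
qed

lemma micro_mult_monom_1_right: "micro_mult P (micro_monom 1 j) = (\<lambda>n. P (n - j))"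
  by (subst micro_mult_const_right) (simp_all add: comm_mult_monom_right, simp add: micro_monom_def)

lemma micro_carrier_vanishes: "P \<in> micro_carrier \<Longrightarrow> \<exists>r. vanishes_above r P"
  by (auto simp: micro_carrier_def)

lemma micro_carrier_vanishes_common:
  assumes "P \<in> micro_carrier" "Q \<in> micro_carrier"
  obtains r where "vanishes_above r P" "vanishes_above r Q"
  using coeff_bound_common[OF assms] unfolding coeff_bound_def by metis

lemma ring_Micro: "ring Micro"
proof (rule ringI, unfold Micro_simps)
  show "abelian_group Micro"
  proof (rule abelian_groupI)
    show "\<exists>Q\<in>carrier Micro. Q \<oplus>\<^bsub>Micro\<^esub> P = \<zero>\<^bsub>Micro\<^esub>" if "P \<in> carrier Micro" for P
      by (rule bexI[of _ "\<lambda>i. - P i"]) (use that in \<open>simp_all add: micro_uminus_closed\<close>)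
    show "\<zero>\<^bsub>Micro\<^esub> \<in> carrier Micro" by (simp add: micro_carrier_finite)
  qed (simp_all add: micro_add_closed algebra_simps)
  show "Group.monoid Micro"
  proof (rule monoidI, unfold Micro_simps)
    show "micro_mult (micro_mult P Q) W = micro_mult P (micro_mult Q W)"
      if c: "P \<in> micro_carrier" "Q \<in> micro_carrier" "W \<in> micro_carrier" for P Q W
    proof -
      obtain r s w where "vanishes_above r P" "vanishes_above s Q" "vanishes_above w W"
        using c[THEN micro_carrier_vanishes] by blast
      then show ?thesis by (rule micro_mult_assoc)
    qed
  qed (simp_all add: micro_mult_closed micro_monom_closed micro_mult_monom_0_left micro_mult_monom_1_right)
  show "micro_mult (\<lambda>i. P i + Q i) W = (\<lambda>i. micro_mult P W i + micro_mult Q W i)"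
    if c: "P \<in> micro_carrier" "Q \<in> micro_carrier" "W \<in> micro_carrier" for P Q W
  proof -
    obtain s where "vanishes_above s W" using micro_carrier_vanishes[OF c(3)] by blast
    moreover obtain r where "vanishes_above r P" "vanishes_above r Q"
      by (rule micro_carrier_vanishes_common[OF c(1,2)])
    ultimately show ?thesis by (simp add: micro_mult_add_left)
  qed
  show "micro_mult W (\<lambda>i. P i + Q i) = (\<lambda>i. micro_mult W P i + micro_mult W Q i)"
    if c: "P \<in> micro_carrier" "Q \<in> micro_carrier" "W \<in> micro_carrier" for P Q W
  proof -
    obtain s where "vanishes_above s W" using micro_carrier_vanishes[OF c(3)] by blast
    moreover obtain r where "vanishes_above r P" "vanishes_above r Q"
      by (rule micro_carrier_vanishes_common[OF c(1,2)])
    ultimately show ?thesis by (simp add: micro_mult_add_right)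
  qed
qed

interpretation Micro: ring Micro by (rule ring_Micro)

lemma finsum_Micro:
  assumes "finite S" "f \<in> S \<rightarrow> micro_carrier"
  shows "(\<Oplus>\<^bsub>Micro\<^esub>x\<in>S. f x) = (\<lambda>i. \<Sum>x\<in>S. f x i)"
  using assms by (induction S rule: finite_induct) simp_all

section \<open>Differential operators and Laurent series as microdifferential operators\<close>

text \<open>As coefficients stand on the left, \<open>pCons a P\<close> is a + P \<partial>, and
  right multiplication by t is the corresponding shift. This is the recursion behind
  multiplicativity.\<close>

lemma micro_of_diff_op_pCons:
  "micro_of_diff_op (pCons a P) = (\<lambda>i. micro_monom a 0 i + micro_mult (micro_of_diff_op P) micro_t i)"
  unfolding micro_t_def micro_mult_monom_1_right
  by (rule ext) (auto simp: micro_of_diff_op_def micro_monom_def coeff_pCons nat_diff_distrib' split: nat.split)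

lemma micro_of_diff_op_partial_lmult:
  "micro_of_diff_op (partial_lmult fps_deriv P) = micro_mult micro_t (micro_of_diff_op P)"
  unfolding micro_mult_t_left
  by (rule ext) (auto simp: micro_of_diff_op_def coeff_partial_lmult nat_diff_distrib' split: nat.split)

lemma vanishes_above_micro_of_diff_op: "vanishes_above (int (degree P)) (micro_of_diff_op P)"
  by (auto simp: micro_of_diff_op_def intro!: coeff_eq_0)

lemma micro_of_diff_op_add: "micro_of_diff_op (P + Q) = (\<lambda>i. micro_of_diff_op P i + micro_of_diff_op Q i)"
  by (auto simp: micro_of_diff_op_def)

interpretation fps_diff_op: derivation_on "UNIV :: complex fps set" fps_deriv
  by unfold_locales (simp_all add: algebra_simps)

text \<open>Multiplicativity is purely algebraic and is proved for all formal power series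
  coefficients; convergence enters only when the image is shown to lie in the ring. The induction
  moves one \<partial> from the left factor to the right one, where it acts as left multiplication
  by t.\<close>

lemma micro_of_diff_op_mult:
  "micro_of_diff_op (diff_op_mult fps_deriv P Q) = micro_mult (micro_of_diff_op P) (micro_of_diff_op Q)"
proof (induction P arbitrary: Q)
  case 0
  have "micro_of_diff_op 0 = micro_monom 0 0" by (auto simp: micro_of_diff_op_def micro_monom_def)
  then show ?case by (simp add: fps_diff_op.mul_0_left micro_mult_monom_0_left) (simp add: micro_monom_def)
next
  case (pCons a P)
  let ?\<iota> = micro_of_diff_op
  have t: "vanishes_above 1 micro_t" by (simp add: micro_t_def micro_monom_def)
  have a: "vanishes_above (int (degree P) + 1) (micro_monom a 0)" by (simp add: micro_monom_def)
  have Pt: "vanishes_above (int (degree P) + 1) (micro_mult (?\<iota> P) micro_t)"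
    using micro_mult_eq_0[OF vanishes_above_micro_of_diff_op t] by blast
  have "micro_mult (?\<iota> (pCons a P)) (?\<iota> Q)
      = (\<lambda>i. micro_mult (micro_monom a 0) (?\<iota> Q) i + micro_mult (micro_mult (?\<iota> P) micro_t) (?\<iota> Q) i)"
    unfolding micro_of_diff_op_pCons by (rule micro_mult_add_left[OF a Pt vanishes_above_micro_of_diff_op])
  also have "micro_mult (micro_mult (?\<iota> P) micro_t) (?\<iota> Q) = micro_mult (?\<iota> P) (micro_mult micro_t (?\<iota> Q))"
    by (rule micro_mult_assoc[OF vanishes_above_micro_of_diff_op t vanishes_above_micro_of_diff_op])
  also have "\<dots> = ?\<iota> (diff_op_mult fps_deriv P (partial_lmult fps_deriv Q))"
    by (simp add: pCons.IH micro_of_diff_op_partial_lmult)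
  also have "micro_mult (micro_monom a 0) (?\<iota> Q) = ?\<iota> (Polynomial.smult a Q)"
    by (auto simp: micro_mult_monom_0_left micro_of_diff_op_def)
  also have "(\<lambda>i. ?\<iota> (Polynomial.smult a Q) i + ?\<iota> (diff_op_mult fps_deriv P (partial_lmult fps_deriv Q)) i)
      = ?\<iota> (diff_op_mult fps_deriv (Polynomial.smult a 1 + pCons 0 P) Q)"
    by (simp only: fps_diff_op.mul_add_left fps_diff_op.mul_smult fps_diff_op.mul_1_left
        fps_diff_op.mul_pCons_0 micro_of_diff_op_add)
  also have "Polynomial.smult a 1 + pCons 0 P = pCons a P" by (simp add: one_pCons)
  finally show ?case by simp
qed

lemma micro_of_diff_op_1: "micro_of_diff_op 1 = micro_monom 1 0"
  by (auto simp: micro_of_diff_op_def micro_monom_def coeff_1)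

lemma micro_of_diff_op_closed:
  assumes "\<And>i. 0 < fps_conv_radius (coeff P i)"
  shows "micro_of_diff_op P \<in> micro_carrier"
proof (rule micro_carrier_finite)
  show "finite {i. micro_of_diff_op P i \<noteq> 0}"
    by (rule finite_subset[of _ "{0..int (degree P)}"])
      (auto simp: micro_of_diff_op_def intro: le_degree dest: le_degree split: if_splits)
qed (simp add: micro_of_diff_op_def assms)

lemma micro_of_diff_op_ring_hom: "micro_of_diff_op \<in> ring_hom conv_diff_ops Micro"
  by (rule ring_hom_memI)
    (auto simp: conv_diff_ops_def diff_op_ring_def micro_of_diff_op_closed micro_of_diff_op_mult
      micro_of_diff_op_add micro_of_diff_op_1)

text \<open>The coefficients are constants, so their sup norms are absolute values and any disc
  serves. Absolute convergence of the part in t^(-1) at \<theta> is stronger than the required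
  condition, which divides by k!.\<close>

lemma micro_of_laurent_closed:
  assumes "0 < fls_conv_radius f" shows "micro_of_laurent f \<in> micro_carrier"
proof -
  have const: "fps_conv_radius (fps_const c) = \<infinity>" for c :: complex by simp
  obtain \<theta> where \<theta>: "0 < ereal \<theta>" "ereal \<theta> < fps_conv_radius (fls_regpart f)"
    using assms ereal_dense2[of 0] unfolding fls_conv_radius_def by blast
  have "summable (\<lambda>k. norm (fls_regpart f $ k * of_real \<theta> ^ k))"
    using \<theta> by (intro abs_summable_in_conv_radius) (simp add: fps_conv_radius_def)
  then have "summable (\<lambda>k. sup_norm (1 / 2) (micro_of_laurent f (- int k)) * (\<theta> ^ k / fact k))"
  proof (rule summable_comparison_test'[where N = 0])
    fix k
    have "sup_norm (1 / 2) (micro_of_laurent f (- int k)) = norm (fls_regpart f $ k)"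
      by (simp add: sup_norm_def micro_of_laurent_def)
    moreover have "\<theta> ^ k / fact k \<le> \<theta> ^ k / 1"
      using \<theta>(1) by (intro divide_left_mono) (auto simp: fact_ge_1)
    then have "norm (fls_regpart f $ k) * (\<theta> ^ k / fact k) \<le> norm (fls_regpart f $ k) * \<theta> ^ k"
      by (intro mult_left_mono) simp_all
    ultimately show "norm (sup_norm (1 / 2) (micro_of_laurent f (- int k)) * (\<theta> ^ k / fact k))
        \<le> norm (fls_regpart f $ k * of_real \<theta> ^ k)"
      using \<theta>(1) by (simp add: norm_mult norm_power abs_mult)
  qed
  then have "\<exists>\<rho> \<theta>. 0 < \<rho> \<and> \<rho> < 1 \<and> 0 < \<theta> \<and>
      summable (\<lambda>k. sup_norm \<rho> (micro_of_laurent f (- int k)) * (\<theta> ^ k / fact k))"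
    using \<theta>(1) by (intro exI[of _ "1 / 2 :: real"] exI[of _ \<theta>]) simp
  moreover have "vanishes_above (- fls_subdegree f) (micro_of_laurent f)"
    by (auto simp: micro_of_laurent_def)
  moreover have "\<forall>i. ereal 1 \<le> fps_conv_radius (micro_of_laurent f i)" by (simp add: micro_of_laurent_def)
  ultimately show ?thesis unfolding micro_carrier_def using zero_less_one by blast
qed

text \<open>Constant coefficients have no eta-derivatives, so only the commutative convolution is
  left; the change of sign of the index accounts for the variable being t^(-1).\<close>

lemma micro_of_laurent_mult:
  "micro_of_laurent (f * g) = micro_mult (micro_of_laurent f) (micro_of_laurent g)"
proof
  fix n
  let ?I = "{fls_subdegree f..- n - fls_subdegree g}"
  let ?h = "\<lambda>i. micro_of_laurent f i * micro_of_laurent g (n - i)"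
  have "micro_mult (micro_of_laurent f) (micro_of_laurent g) n = Sum_any ?h"
    by (subst micro_mult_const_right) (simp_all add: micro_of_laurent_def comm_mult_def)
  also have "\<dots> = sum ?h (uminus ` ?I)"
  proof (rule Sum_any.expand_superset)
    show "{i. ?h i \<noteq> 0} \<subseteq> uminus ` ?I"
    proof
      fix i assume "i \<in> {i. ?h i \<noteq> 0}"
      then have "fls_nth f (- i) \<noteq> 0" "fls_nth g (i - n) \<noteq> 0" by (auto simp: micro_of_laurent_def)
      then have "fls_subdegree f \<le> - i" "fls_subdegree g \<le> i - n"
        using fls_eq0_below_subdegree not_less by blast+
      then show "i \<in> uminus ` ?I" by (intro image_eqI[of _ _ "- i"]) auto
    qed
  qed simp
  also have "\<dots> = (\<Sum>i\<in>?I. ?h (- i))" by (subst sum.reindex) (auto simp: inj_on_def)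
  also have "\<dots> = fps_const (\<Sum>i\<in>?I. fls_nth f i * fls_nth g (- n - i))"
  proof -
    have "- (n - - i) = - n - i" for i by simp
    then show ?thesis unfolding micro_of_laurent_def fps_const_sum by (simp only: minus_minus fps_const_mult)
  qed
  also have "\<dots> = micro_of_laurent (f * g) n"
    by (simp add: micro_of_laurent_def fls_times_nth(2))
  finally show "micro_of_laurent (f * g) n = micro_mult (micro_of_laurent f) (micro_of_laurent g) n" ..
qed

lemma micro_of_laurent_ring_hom: "micro_of_laurent \<in> ring_hom conv_laurent Micro"
  by (rule ring_hom_memI)
    (auto simp: conv_laurent_def micro_of_laurent_closed micro_of_laurent_mult,
     auto simp: micro_of_laurent_def micro_monom_def)

section \<open>Evaluation of Weyl algebra elements\<close>

lemma Weyl_simps [simp]: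
  "carrier Weyl = UNIV" "P \<otimes>\<^bsub>Weyl\<^esub> Q = diff_op_mult pderiv P Q"
  "P \<oplus>\<^bsub>Weyl\<^esub> Q = P + Q" "\<zero>\<^bsub>Weyl\<^esub> = 0" "\<one>\<^bsub>Weyl\<^esub> = 1"
  by (simp_all add: Weyl_def diff_op_ring_def)

lemma ring_hom_finsum:
  assumes "ring A" "ring B" "\<phi> \<in> ring_hom A B" "finite S" "f \<in> S \<rightarrow> carrier A"
  shows "\<phi> (\<Oplus>\<^bsub>A\<^esub>x\<in>S. f x) = (\<Oplus>\<^bsub>B\<^esub>x\<in>S. \<phi> (f x))"
proof -
  interpret A: ring A by fact
  interpret B: ring B by fact
  show ?thesis
    using assms(4,5)
    by (induction S rule: finite_induct)
      (auto simp: Pi_def ring_hom_zero[OF assms(3,1,2)] ring_hom_add[OF assms(3)] ring_hom_closed[OF assms(3)])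
qed

lemma ring_hom_nat_pow:
  assumes "ring A" "\<phi> \<in> ring_hom A B" "u \<in> carrier A"
  shows "\<phi> (u [^]\<^bsub>A\<^esub> i) = \<phi> u [^]\<^bsub>B\<^esub> (i :: nat)"
proof -
  interpret A: ring A by fact
  show ?thesis
    using assms(3)
    by (induction i) (simp_all add: nat_pow_def ring_hom_one[OF assms(2)] ring_hom_mult[OF assms(2)]
        flip: nat_pow_def)
qed

lemma ring_hom_weyl_eval:
  assumes A: "ring A" and B: "ring B" and \<phi>: "\<phi> \<in> ring_hom A B"
    and \<iota>: "\<And>c. \<iota> c \<in> carrier A" and u: "u \<in> carrier A" and v: "v \<in> carrier A"
  shows "\<phi> (weyl_eval A \<iota> u v P) = weyl_eval B (\<lambda>c. \<phi> (\<iota> c)) (\<phi> u) (\<phi> v) P"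
proof -
  interpret A: ring A by fact
  interpret B: ring B by fact
  have hom_term: "\<phi> (\<iota> c \<otimes>\<^bsub>A\<^esub> u [^]\<^bsub>A\<^esub> i \<otimes>\<^bsub>A\<^esub> v [^]\<^bsub>A\<^esub> j)
      = \<phi> (\<iota> c) \<otimes>\<^bsub>B\<^esub> \<phi> u [^]\<^bsub>B\<^esub> i \<otimes>\<^bsub>B\<^esub> \<phi> v [^]\<^bsub>B\<^esub> j" for c and i j :: nat
    using \<iota> u v by (simp add: ring_hom_mult[OF \<phi>] ring_hom_nat_pow[OF A \<phi>])
  have closed: "\<iota> c \<otimes>\<^bsub>A\<^esub> u [^]\<^bsub>A\<^esub> i \<otimes>\<^bsub>A\<^esub> v [^]\<^bsub>A\<^esub> j \<in> carrier A" for c and i j :: nat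
    using \<iota> u v by simp
  show ?thesis
    unfolding weyl_eval_def
    by (subst ring_hom_finsum[OF A B \<phi>], simp, blast intro: A.finsum_closed closed)+
      (simp add: closed hom_term Pi_def)
qed

lemma micro_monom_0_mult: "micro_mult (micro_monom a 0) (micro_monom b j) = micro_monom (a * b) j"
  unfolding micro_mult_monom_0_left by (auto simp: micro_monom_def)

lemma micro_eta_pow: "micro_eta [^]\<^bsub>Micro\<^esub> i = micro_monom (fps_X ^ i) 0" for i :: nat
  by (induction i) (simp_all add: micro_eta_def micro_monom_0_mult mult.commute)

lemma micro_t_pow: "micro_t [^]\<^bsub>Micro\<^esub> j = micro_monom 1 (int j)" for j :: nat
  by (induction j) (simp_all add: micro_t_def micro_mult_monom_1_right, auto simp: micro_monom_def)

text \<open>In each monomial constants, powers of eta and powers of t already stand in normal order,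
  so the evaluation merely collects coefficients. Multiplicativity of \<open>micro_hom_eta\<close>
  can then be inherited from the two factors.\<close>

lemma micro_hom_eta_eq: "micro_hom_eta P = micro_of_diff_op (map_poly fps_of_poly P)"
proof -
  let ?m = "\<lambda>j i. micro_monom (fps_const (coeff (coeff P j) i) * fps_X ^ i) (int j)"
  have rad: "0 < fps_conv_radius (fps_const c * fps_X ^ i)" for c :: complex and i
    using fps_conv_radius_mult[of "fps_const c" "fps_X ^ i :: complex fps"] by (auto intro: less_le_trans)
  then have closed: "?m j i \<in> micro_carrier" for j i by (rule micro_monom_closed)
  have "micro_const (coeff (coeff P j) i) \<otimes>\<^bsub>Micro\<^esub> micro_eta [^]\<^bsub>Micro\<^esub> i \<otimes>\<^bsub>Micro\<^esub> micro_t [^]\<^bsub>Micro\<^esub> j = ?m j i" for i j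
    by (simp add: micro_eta_pow micro_t_pow micro_const_def micro_monom_0_mult)
  then have "micro_hom_eta P = (\<Oplus>\<^bsub>Micro\<^esub>j\<in>{..degree P}. \<Oplus>\<^bsub>Micro\<^esub>i\<in>{..degree (coeff P j)}. ?m j i)"
    unfolding micro_hom_eta_def weyl_eval_def by simp
  also have "\<dots> = (\<Oplus>\<^bsub>Micro\<^esub>j\<in>{..degree P}. (\<lambda>n. \<Sum>i\<le>degree (coeff P j). ?m j i n))"
    using closed by (simp add: finsum_Micro)
  also have "\<dots> = (\<lambda>n. \<Sum>j\<le>degree P. \<Sum>i\<le>degree (coeff P j). ?m j i n)"
  proof (rule finsum_Micro)
    \<comment> \<open>Membership of the pointwise inner sums follows by reading them back as sums in
      the ring.\<close>
    have "(\<lambda>n. \<Sum>i\<le>degree (coeff P j). ?m j i n) = (\<Oplus>\<^bsub>Micro\<^esub>i\<in>{..degree (coeff P j)}. ?m j i)" for j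
      using closed by (simp add: finsum_Micro)
    then show "(\<lambda>j n. \<Sum>i\<le>degree (coeff P j). ?m j i n) \<in> {..degree P} \<rightarrow> micro_carrier"
      using closed Micro.finsum_closed by (metis (no_types, lifting) Micro_simps(1) Pi_I)
  qed simp
  also have "\<dots> = micro_of_diff_op (map_poly fps_of_poly P)"
  proof
    fix n
    have poly: "(\<Sum>i\<le>degree q. fps_const (coeff q i) * fps_X ^ i) = fps_of_poly q" for q :: "complex poly"
      by (subst (3) poly_as_sum_of_monoms[symmetric]) (simp add: fps_of_poly_sum fps_of_poly_monom)
    have "(\<Sum>j\<le>degree P. \<Sum>i\<le>degree (coeff P j). ?m j i n)
        = (\<Sum>j\<le>degree P. if int j = n then fps_of_poly (coeff P j) else 0)"
      by (intro sum.cong refl) (auto simp: micro_monom_def poly)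
    also have "\<dots> = micro_of_diff_op (map_poly fps_of_poly P) n"
    proof (cases "n \<ge> 0")
      case True
      then have "int j = n \<longleftrightarrow> j = nat n" for j by auto
      then show ?thesis using True
        by (simp add: micro_of_diff_op_def coeff_map_poly coeff_eq_0)
    qed (auto simp: micro_of_diff_op_def intro!: sum.neutral)
    finally show "(\<Sum>j\<le>degree P. \<Sum>i\<le>degree (coeff P j). ?m j i n) = micro_of_diff_op (map_poly fps_of_poly P) n" .
  qed
  finally show ?thesis .
qed

section \<open>Polynomial coefficients inside power series coefficients\<close>

lemma map_poly_fps_of_poly_add:
  "map_poly fps_of_poly (P + Q) = map_poly fps_of_poly P + map_poly fps_of_poly Q"
  by (rule poly_eqI) (simp add: coeff_map_poly fps_of_poly_add)

lemma map_poly_fps_of_poly_smult: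
  "map_poly fps_of_poly (Polynomial.smult a P) = Polynomial.smult (fps_of_poly a) (map_poly fps_of_poly P)"
  by (rule poly_eqI) (simp add: coeff_map_poly fps_of_poly_mult)

lemma map_poly_fps_of_poly_partial_lmult:
  "map_poly fps_of_poly (partial_lmult pderiv P) = partial_lmult fps_deriv (map_poly fps_of_poly P)"
  by (rule poly_eqI)
    (simp add: coeff_map_poly coeff_partial_lmult fps_of_poly_add fps_of_poly_pderiv split: nat.split)

lemma map_poly_fps_of_poly_mult:
  fixes P Q :: "complex poly poly"
  shows "map_poly fps_of_poly (diff_op_mult pderiv P Q)
    = diff_op_mult fps_deriv (map_poly fps_of_poly P) (map_poly fps_of_poly Q)"
proof -
  have iter: "map_poly fps_of_poly ((partial_lmult pderiv ^^ i) Q)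
      = (partial_lmult fps_deriv ^^ i) (map_poly fps_of_poly Q)" for i
    by (induction i) (simp_all add: map_poly_fps_of_poly_partial_lmult)
  have sum: "map_poly fps_of_poly (sum f S) = (\<Sum>x\<in>S. map_poly fps_of_poly (f x))"
    for f :: "nat \<Rightarrow> complex poly poly" and S
    by (induction S rule: infinite_finite_induct) (simp_all add: map_poly_fps_of_poly_add)
  have "degree (map_poly fps_of_poly P) \<le> degree P"
    by (rule degree_le) (simp add: coeff_map_poly coeff_eq_0)
  then show ?thesis
    by (simp add: fps_diff_op.mul_alt[of _ "degree P"])
      (simp add: diff_op_mult_def sum map_poly_fps_of_poly_smult iter coeff_map_poly)
qed

lemma micro_hom_eta_closed: "micro_hom_eta P \<in> micro_carrier"
  unfolding micro_hom_eta_eq by (rule micro_of_diff_op_closed) (simp add: coeff_map_poly)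

lemma micro_hom_eta_ring_hom: "micro_hom_eta \<in> ring_hom Weyl Micro"
proof (rule ring_hom_memI)
  show "micro_hom_eta \<one>\<^bsub>Weyl\<^esub> = \<one>\<^bsub>Micro\<^esub>"
    by (simp add: micro_hom_eta_eq micro_of_diff_op_1)
qed (simp_all add: micro_hom_eta_closed, simp_all add: micro_hom_eta_eq map_poly_fps_of_poly_mult
    micro_of_diff_op_mult map_poly_fps_of_poly_add micro_of_diff_op_add)

text \<open>A ring homomorphism carries an evaluation to the evaluation at the images, so only
  constants and the two generators have to be compared. This is the compatibility required by the
  tower.\<close>

lemma micro_hom_eta_fourier_hom: "micro_hom_eta (fourier_hom P) = micro_hom_t P"
proof -
  have "micro_hom_eta (weyl_const c) = micro_const c" for c
    by (rule ext) (simp add: micro_hom_eta_eq weyl_const_def map_poly_pCons micro_of_diff_op_def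
        micro_const_def micro_monom_def fps_of_poly_const coeff_pCons split: nat.split)
  moreover have "micro_hom_eta (- weyl_d) = micro_minus_t"
    by (rule ext) (auto simp add: micro_hom_eta_eq weyl_d_def map_poly_pCons micro_of_diff_op_def
        micro_minus_t_def micro_monom_def fps_of_poly_uminus coeff_pCons split: nat.split)
  moreover have "micro_hom_eta weyl_x = micro_eta"
    by (rule ext) (simp add: micro_hom_eta_eq weyl_x_def map_poly_pCons micro_of_diff_op_def
        micro_eta_def micro_monom_def coeff_pCons split: nat.split)
  ultimately show ?thesis
    unfolding fourier_hom_def micro_hom_t_def
    by (subst ring_hom_weyl_eval[OF ring_Weyl ring_Micro micro_hom_eta_ring_hom]) simp_all
qed

theorem mainTheorem5:
  fixes M :: "(complex poly poly, 'm, 'c) module_scheme"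
  assumes "holonomic M"
  shows "(\<exists>!\<Upsilon>. is_Upsilon M \<Upsilon>) \<and>
    (\<forall>\<Upsilon>. is_Upsilon M \<Upsilon> \<longrightarrow>
       left_module_iso conv_diff_ops
         (restrict_scalars micro_of_diff_op (mu (fourier M)))
         (restrict_scalars micro_of_diff_op (Micro_mod M)) \<Upsilon> \<and>
       left_module_iso conv_laurent
         (restrict_scalars micro_of_laurent (mu (fourier M)))
         (restrict_scalars micro_of_laurent (Micro_mod M)) \<Upsilon>)"
proof -
  have M: "left_module Weyl M" using assms by (simp add: holonomic_def)
  interpret S: scalar_extension Weyl Weyl fourier_hom M
    using M ring_Weyl by (simp add: scalar_extension_def scalar_extension_axioms_def)
  have hom_t_closed: "micro_hom_t P \<in> micro_carrier" for P
    using micro_hom_eta_closed[of "fourier_hom P"] by (simp add: micro_hom_eta_fourier_hom)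
  interpret T: scalar_extension_tower Weyl Weyl Micro fourier_hom micro_hom_eta micro_hom_t M
    using M ring_Micro S.left_module_T S.scalar_extension_axioms
    by (simp add: scalar_extension_tower_def scalar_extension_tower_axioms_def scalar_extension_def
        scalar_extension_axioms_def micro_hom_eta_closed hom_t_closed micro_hom_eta_ring_hom
        micro_hom_eta_fourier_hom)
  let ?Q = "mu (fourier M)"
  have is_Upsilon: "is_Upsilon M \<Upsilon> \<longleftrightarrow> \<Upsilon> \<in> extensional (carrier ?Q) \<and>
      \<Upsilon> \<in> hom (add_monoid ?Q) (add_monoid (Micro_mod M)) \<and>
      (\<forall>\<alpha>\<in>micro_carrier. \<forall>m\<in>carrier M. \<Upsilon> (T.gen \<alpha> m) = T.S.pt \<alpha> m)" for \<Upsilon>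
    by (simp add: is_Upsilon_def fourier_elem_def fourier_def)
  have Q: "?Q = T.S\<^sub>2.T" by (simp add: mu_def fourier_def)
  have R: "Micro_mod M = T.S.T" by (simp add: Micro_mod_def)
  obtain \<Upsilon>\<^sub>0 where \<Upsilon>\<^sub>0: "\<Upsilon>\<^sub>0 \<in> hom (add_monoid ?Q) (add_monoid (Micro_mod M))"
    "\<And>\<alpha> m. \<alpha> \<in> micro_carrier \<Longrightarrow> m \<in> carrier M \<Longrightarrow> \<Upsilon>\<^sub>0 (T.gen \<alpha> m) = T.S.pt \<alpha> m"
    using T.exists_hom_to_extension unfolding Q R by (metis Micro_simps(1))
  have gen_closed: "T.gen \<alpha> m \<in> carrier ?Q" if "\<alpha> \<in> micro_carrier" "m \<in> carrier M" for \<alpha> m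
    unfolding Q using T.gen_closed that by simp
  interpret Q: abelian_group ?Q unfolding Q by (rule T.S\<^sub>2.abelian_group_T)
  \<comment> \<open>Restriction fixes the value outside the carrier, so that uniqueness can hold as
    an equality of total functions.\<close>
  have "is_Upsilon M (restrict \<Upsilon>\<^sub>0 (carrier ?Q))"
    using \<Upsilon>\<^sub>0 gen_closed unfolding is_Upsilon hom_def by auto
  moreover have "\<Upsilon> = \<Upsilon>'" if "is_Upsilon M \<Upsilon>" "is_Upsilon M \<Upsilon>'" for \<Upsilon> \<Upsilon>'
  proof (rule extensionalityI)
    show "\<Upsilon> \<in> extensional (carrier ?Q)" "\<Upsilon>' \<in> extensional (carrier ?Q)"
      using that is_Upsilon by blast+
    show "\<Upsilon> x = \<Upsilon>' x" if x: "x \<in> carrier ?Q" for x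
      by (rule T.hom_eq_on_gen[OF abelian_group.a_group[OF T.S.abelian_group_T]])
        (use \<open>is_Upsilon M \<Upsilon>\<close> \<open>is_Upsilon M \<Upsilon>'\<close> x in \<open>auto simp: is_Upsilon Q R\<close>)
  qed
  moreover have "left_module_iso conv_diff_ops
         (restrict_scalars micro_of_diff_op ?Q) (restrict_scalars micro_of_diff_op (Micro_mod M)) \<Upsilon> \<and>
       left_module_iso conv_laurent
         (restrict_scalars micro_of_laurent ?Q) (restrict_scalars micro_of_laurent (Micro_mod M)) \<Upsilon>"
    if "is_Upsilon M \<Upsilon>" for \<Upsilon>
  proof -
    \<comment> \<open>Linearity over the whole ring of microdifferential operators; the two required
      structures are restrictions of this one.\<close>
    have iso: "left_module_iso Micro ?Q (Micro_mod M) \<Upsilon>"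
      unfolding Q R by (rule T.hom_to_extension_iso) (use that in \<open>auto simp: is_Upsilon Q R\<close>)
    have "ring conv_laurent" using field_conv_laurent by (simp add: field_def domain_def cring_def)
    then show ?thesis
      using iso by (intro conjI left_module_iso_restrict_scalars[OF _ _ iso]
          ring_conv_diff_ops micro_of_diff_op_ring_hom micro_of_laurent_ring_hom)
  qed
  ultimately show ?thesis by blast
qed

end
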